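(* Let $H$ be a Hopf algebra over a field $k$ and let $A$ be a (right) $H$-comodule algebra (both $A$ and $H$ can be infinite dimensional) whose canonical map $\mathrm{can}:A\otimes_{A^{co\,H}}A\to A\otimes H$ is epimorphic (surjective). Then every $Q\in\mathrm{Quot}_{gen}(H)$ for which $A^{co\,Q}\subseteq A$ is a $Q$-Galois extension is a closed element of the Galois connection $(\phi,\psi)$ between $\mathrm{Quot}_{gen}(H)$ and $\mathrm{Sub}_{alg}(A/A^{co\,H})$, where $\phi(Q)=A^{co\,Q}$; that is, $\psi\phi(Q)=Q$.
   Context: A (right) $H$-comodule algebra is an associative unital algebra $A$ with a coassociative and counital coaction $\delta:A\to A\otimes H$, $\delta(a)=a_{(0)}\otimes a_{(1)}$, which is an algebra map; $A^{co\,H}=\{a\in A:\delta(a)=a\otimes 1\}$. The canonical map is $\mathrm{can}(a\otimes b)=ab_{(0)}\otimes b_{(1)}$. $\mathrm{Quot}_{gen}(H)=\{H/I: I\text{ a coideal and a right ideal of }H\}$, ordered by $H/I\succeq H/J$ iff $I\subseteq J$; it is a complete lattice. For $Q=H/I$ with quotient map $\pi:H\to Q$, $A^{co\,Q}=\{a\in A:(\mathrm{id}\otimes\pi)\delta(a)=a\otimes\pi(1)\}$, a subalgebra of $A$. The extension $A^{co\,Q}\subseteq A$ is $Q$-Galois if $\mathrm{can}_Q:A\otimes_{A^{co\,Q}}A\to A\otimes Q$, $a\otimes b\mapsto ab_{(0)}\otimes\pi(b_{(1)})$, is bijective. $\mathrm{Sub}_{alg}(A/A^{co\,H})$ is the lattice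 of subalgebras of $A$ containing $A^{co\,H}$, ordered by inclusion. The order-reversing map $\phi(Q)=A^{co\,Q}$ is part of a unique Galois connection $(\phi,\psi)$, with $\psi(B)=\sup\{Q\in\mathrm{Quot}_{gen}(H):B\subseteq A^{co\,Q}\}$. An element is closed if it is fixed by the composite $\psi\phi$ (respectively $\phi\psi$).
   Formalization: The comodule algebra A is assumed to be nonzero (1 ≠ 0 in A); for A = 0 every can_Q is bijective and all A^{co Q} coincide, so the claim fails, for example for H = k[Z/2] and Q = H/ker ε. *)

theory Defs
  imports "HOL-Algebra.Algebra"
begin

section \<open>Tensor products\<close>

text \<open>
  The tensor product of a right module \<open>M\<close> and a left module \<open>N\<close> over a set \<open>S\<close> of scalars (acting
  by \<open>ra\<close> and \<open>la\<close>) is the free abelian group on \<open>carrier M \<times> carrier N\<close> modulo the subgroup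
  \<open>tensor_rel\<close> generated by biadditivity and \<open>S\<close>-balancedness. The groups
  \<^const>\<open>free_Abelian_group\<close> and \<^const>\<open>FactGroup\<close>, and hence \<open>tensor_group\<close>, are written
  multiplicatively. Only the carrier and the addition of \<open>M\<close> and \<open>N\<close> are used.
\<close>

definition tensor_rel ::
  "'s set \<Rightarrow> ('m \<Rightarrow> 's \<Rightarrow> 'm) \<Rightarrow> ('s \<Rightarrow> 'n \<Rightarrow> 'n) \<Rightarrow> ('m, 'x) ring_scheme \<Rightarrow> ('n, 'y) ring_scheme
    \<Rightarrow> (('m \<times> 'n) \<Rightarrow>\<^sub>0 int) set"
  where "tensor_rel S ra la M N =
    generate (free_Abelian_group (carrier M \<times> carrier N))
     ({frag_of (m \<oplus>\<^bsub>M\<^esub> m', n) - frag_of (m, n) - frag_of (m', n) | m m' n.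
         m \<in> carrier M \<and> m' \<in> carrier M \<and> n \<in> carrier N} \<union>
      {frag_of (m, n \<oplus>\<^bsub>N\<^esub> n') - frag_of (m, n) - frag_of (m, n') | m n n'.
         m \<in> carrier M \<and> n \<in> carrier N \<and> n' \<in> carrier N} \<union>
      {frag_of (ra m s, n) - frag_of (m, la s n) | m s n.
         m \<in> carrier M \<and> s \<in> S \<and> n \<in> carrier N})"

definition tensor_group ::
  "'s set \<Rightarrow> ('m \<Rightarrow> 's \<Rightarrow> 'm) \<Rightarrow> ('s \<Rightarrow> 'n \<Rightarrow> 'n) \<Rightarrow> ('m, 'x) ring_scheme \<Rightarrow> ('n, 'y) ring_scheme
    \<Rightarrow> (('m \<times> 'n) \<Rightarrow>\<^sub>0 int) set monoid"
  where "tensor_group S ra la M N =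
    free_Abelian_group (carrier M \<times> carrier N) Mod tensor_rel S ra la M N"

definition pure_tensor ::
  "'s set \<Rightarrow> ('m \<Rightarrow> 's \<Rightarrow> 'm) \<Rightarrow> ('s \<Rightarrow> 'n \<Rightarrow> 'n) \<Rightarrow> ('m, 'x) ring_scheme \<Rightarrow> ('n, 'y) ring_scheme
    \<Rightarrow> 'm \<Rightarrow> 'n \<Rightarrow> (('m \<times> 'n) \<Rightarrow>\<^sub>0 int) set"
  where "pure_tensor S ra la M N m n =
    tensor_rel S ra la M N #>\<^bsub>free_Abelian_group (carrier M \<times> carrier N)\<^esub> frag_of (m, n)"

text \<open>
  The homomorphism from a tensor product to the commutative group \<open>G\<close> (written multiplicatively)
  with \<open>m \<otimes> n \<mapsto> f m n\<close>. For a biadditive balanced \<open>f\<close> the extension of \<open>f\<close> to the free abelian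
  group is constant on each coset \<open>U\<close>, and \<open>tensor_lift G f U\<close> is its value there.
\<close>

definition tensor_lift ::
  "('g, 'x) monoid_scheme \<Rightarrow> ('m \<Rightarrow> 'n \<Rightarrow> 'g) \<Rightarrow> (('m \<times> 'n) \<Rightarrow>\<^sub>0 int) set \<Rightarrow> 'g"
  where "tensor_lift G f U =
    the_elem ((\<lambda>r. finprod G (\<lambda>p. f (fst p) (snd p) [^]\<^bsub>G\<^esub> Poly_Mapping.lookup r p)
                (Poly_Mapping.keys r)) ` U)"

text \<open>
  Tensor products over a field \<open>K\<close>. If \<open>M\<close> and \<open>N\<close> are algebras, \<open>mult\<close> and \<open>one\<close> make
  \<open>tensor K M N\<close> the tensor product algebra, with \<open>(m \<otimes> n)(m' \<otimes> n') = m m' \<otimes> n n'\<close>; for mere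
  vector spaces these two fields carry no meaning.
\<close>

definition tens ::
  "('k, 'z) ring_scheme \<Rightarrow> ('k, 'm, 'x) module_scheme \<Rightarrow> ('k, 'n, 'y) module_scheme
    \<Rightarrow> 'm \<Rightarrow> 'n \<Rightarrow> (('m \<times> 'n) \<Rightarrow>\<^sub>0 int) set"
  where "tens K M N =
    pure_tensor (carrier K) (\<lambda>m c. c \<odot>\<^bsub>M\<^esub> m) (\<lambda>c n. c \<odot>\<^bsub>N\<^esub> n) M N"

definition tensor ::
  "('k, 'z) ring_scheme \<Rightarrow> ('k, 'm, 'x) module_scheme \<Rightarrow> ('k, 'n, 'y) module_scheme
    \<Rightarrow> ('k, (('m \<times> 'n) \<Rightarrow>\<^sub>0 int) set) module"
  where "tensor K M N =
    (let T = tensor_group (carrier K) (\<lambda>m c. c \<odot>\<^bsub>M\<^esub> m) (\<lambda>c n. c \<odot>\<^bsub>N\<^esub> n) M N in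
      \<lparr>carrier = carrier T,
       monoid.mult = (\<lambda>U V. tensor_lift T (\<lambda>m n. tensor_lift T
                (\<lambda>m' n'. tens K M N (m \<otimes>\<^bsub>M\<^esub> m') (n \<otimes>\<^bsub>N\<^esub> n')) V) U),
       one = tens K M N \<one>\<^bsub>M\<^esub> \<one>\<^bsub>N\<^esub>,
       ring.zero = \<one>\<^bsub>T\<^esub>,
       add = (\<otimes>\<^bsub>T\<^esub>),
       smult = (\<lambda>c. tensor_lift T (\<lambda>m n. tens K M N (c \<odot>\<^bsub>M\<^esub> m) n))\<rparr>)"

text \<open>The map \<open>f \<otimes> g\<close> with codomain \<open>M' \<otimes> N'\<close>.\<close>

definition tensor_map ::
  "('k, 'z) ring_scheme \<Rightarrow> ('k, 'm1, 'x) module_scheme \<Rightarrow> ('k, 'n1, 'y) module_scheme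
    \<Rightarrow> ('m \<Rightarrow> 'm1) \<Rightarrow> ('n \<Rightarrow> 'n1) \<Rightarrow> (('m \<times> 'n) \<Rightarrow>\<^sub>0 int) set \<Rightarrow> (('m1 \<times> 'n1) \<Rightarrow>\<^sub>0 int) set"
  where "tensor_map K M' N' f g =
    tensor_lift (add_monoid (tensor K M' N')) (\<lambda>m n. tens K M' N' (f m) (g n))"

text \<open>The associativity isomorphism \<open>(L \<otimes> M) \<otimes> N \<rightarrow> L \<otimes> (M \<otimes> N)\<close>.\<close>

definition tensor_assoc ::
  "('k, 'z) ring_scheme \<Rightarrow> ('k, 'l, 'w) module_scheme \<Rightarrow> ('k, 'm, 'x) module_scheme
    \<Rightarrow> ('k, 'n, 'y) module_scheme
    \<Rightarrow> (((('l \<times> 'm) \<Rightarrow>\<^sub>0 int) set \<times> 'n) \<Rightarrow>\<^sub>0 int) set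
    \<Rightarrow> (('l \<times> (('m \<times> 'n) \<Rightarrow>\<^sub>0 int) set) \<Rightarrow>\<^sub>0 int) set"
  where "tensor_assoc K L M N =
    (let T = add_monoid (tensor K L (tensor K M N)) in
      tensor_lift T (\<lambda>x n. tensor_lift T
        (\<lambda>l m. tens K L (tensor K M N) l (tens K M N m n)) x))"


section \<open>Hopf algebras and comodule algebras\<close>

text \<open>
  The library's \<^locale>\<open>algebra\<close> is restricted to commutative algebras.
\<close>

locale k_algebra = module K A + field K + ring A for K (structure) and A (structure) +
  assumes smult_mult_left:
      "\<lbrakk>c \<in> carrier K; x \<in> carrier A; y \<in> carrier A\<rbrakk> \<Longrightarrow>
        (c \<odot>\<^bsub>A\<^esub> x) \<otimes>\<^bsub>A\<^esub> y = c \<odot>\<^bsub>A\<^esub> (x \<otimes>\<^bsub>A\<^esub> y)"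
    and smult_mult_right:
      "\<lbrakk>c \<in> carrier K; x \<in> carrier A; y \<in> carrier A\<rbrakk> \<Longrightarrow>
        x \<otimes>\<^bsub>A\<^esub> (c \<odot>\<^bsub>A\<^esub> y) = c \<odot>\<^bsub>A\<^esub> (x \<otimes>\<^bsub>A\<^esub> y)"

definition linear_map ::
  "('k, 'z) ring_scheme \<Rightarrow> ('k, 'm, 'x) module_scheme \<Rightarrow> ('k, 'n, 'y) module_scheme
    \<Rightarrow> ('m \<Rightarrow> 'n) \<Rightarrow> bool"
  where "linear_map K M N f \<longleftrightarrow>
    f \<in> carrier M \<rightarrow> carrier N \<and>
    (\<forall>x\<in>carrier M. \<forall>y\<in>carrier M. f (x \<oplus>\<^bsub>M\<^esub> y) = f x \<oplus>\<^bsub>N\<^esub> f y) \<and>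
    (\<forall>c\<in>carrier K. \<forall>x\<in>carrier M. f (c \<odot>\<^bsub>M\<^esub> x) = c \<odot>\<^bsub>N\<^esub> f x)"

locale hopf_algebra = k_algebra K H for K (structure) and H (structure) +
  fixes \<Delta> and \<epsilon> and S
  assumes comult_ring_hom: "\<Delta> \<in> ring_hom H (tensor K H H)"
    and comult_linear: "linear_map K H (tensor K H H) \<Delta>"
    and counit_ring_hom: "\<epsilon> \<in> ring_hom H K"
    and counit_linear:
      "\<lbrakk>c \<in> carrier K; h \<in> carrier H\<rbrakk> \<Longrightarrow> \<epsilon> (c \<odot>\<^bsub>H\<^esub> h) = c \<otimes>\<^bsub>K\<^esub> \<epsilon> h"
    and coassoc:
      "h \<in> carrier H \<Longrightarrow>
        tensor_assoc K H H H (tensor_map K (tensor K H H) H \<Delta> (\<lambda>x. x) (\<Delta> h)) =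
        tensor_map K H (tensor K H H) (\<lambda>x. x) \<Delta> (\<Delta> h)"
    and counit_left:
      "h \<in> carrier H \<Longrightarrow> tensor_lift (add_monoid H) (\<lambda>x y. \<epsilon> x \<odot>\<^bsub>H\<^esub> y) (\<Delta> h) = h"
    and counit_right:
      "h \<in> carrier H \<Longrightarrow> tensor_lift (add_monoid H) (\<lambda>x y. \<epsilon> y \<odot>\<^bsub>H\<^esub> x) (\<Delta> h) = h"
    and antipode_linear: "linear_map K H H S"
    and antipode_left:
      "h \<in> carrier H \<Longrightarrow>
        tensor_lift (add_monoid H) (\<lambda>x y. S x \<otimes>\<^bsub>H\<^esub> y) (\<Delta> h) = \<epsilon> h \<odot>\<^bsub>H\<^esub> \<one>\<^bsub>H\<^esub>"
    and antipode_right: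
      "h \<in> carrier H \<Longrightarrow>
        tensor_lift (add_monoid H) (\<lambda>x y. x \<otimes>\<^bsub>H\<^esub> S y) (\<Delta> h) = \<epsilon> h \<odot>\<^bsub>H\<^esub> \<one>\<^bsub>H\<^esub>"

locale comodule_algebra =
  hopf_algebra K H \<Delta> \<epsilon> S + A: k_algebra K A
  for K (structure) and H (structure) and \<Delta> and \<epsilon> and S and A (structure) +
  fixes \<delta>
  assumes coaction_ring_hom: "\<delta> \<in> ring_hom A (tensor K A H)"
    and coaction_linear: "linear_map K A (tensor K A H) \<delta>"
    and coaction_coassoc:
      "a \<in> carrier A \<Longrightarrow>
        tensor_assoc K A H H (tensor_map K (tensor K A H) H \<delta> (\<lambda>x. x) (\<delta> a)) =
        tensor_map K A (tensor K H H) (\<lambda>x. x) \<Delta> (\<delta> a)"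
    and coaction_counit:
      "a \<in> carrier A \<Longrightarrow> tensor_lift (add_monoid A) (\<lambda>x h. \<epsilon> h \<odot>\<^bsub>A\<^esub> x) (\<delta> a) = a"


section \<open>Generalised quotients\<close>

definition coideal ::
  "('k, 'z) ring_scheme \<Rightarrow> ('k, 'h, 'x) module_scheme
    \<Rightarrow> ('h \<Rightarrow> (('h \<times> 'h) \<Rightarrow>\<^sub>0 int) set) \<Rightarrow> ('h \<Rightarrow> 'k) \<Rightarrow> 'h set \<Rightarrow> bool"
  where "coideal K H \<Delta> \<epsilon> I \<longleftrightarrow>
    submodule I K H \<and>
    \<Delta> ` I \<subseteq> generate (add_monoid (tensor K H H))
              ({tens K H H i h | i h. i \<in> I \<and> h \<in> carrier H} \<union>
               {tens K H H h i | h i. h \<in> carrier H \<and> i \<in> I}) \<and>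
    (\<forall>i\<in>I. \<epsilon> i = \<zero>\<^bsub>K\<^esub>)"

definition right_ideal :: "('h, 'x) ring_scheme \<Rightarrow> 'h set \<Rightarrow> bool"
  where "right_ideal H I \<longleftrightarrow>
    additive_subgroup I H \<and> (\<forall>i\<in>I. \<forall>h\<in>carrier H. i \<otimes>\<^bsub>H\<^esub> h \<in> I)"

text \<open>
  The quotient vector space \<open>H/I\<close>, with projection \<open>h \<mapsto> I +>\<^bsub>H\<^esub> h\<close>. As \<open>I\<close> need not be a
  two-sided ideal, there is no multiplication.
\<close>

definition quot_module :: "('k, 'h, 'x) module_scheme \<Rightarrow> 'h set \<Rightarrow> ('k, 'h set) module"
  where "quot_module H I =
    \<lparr>carrier = a_rcosets\<^bsub>H\<^esub> I, monoid.mult = undefined, one = I +>\<^bsub>H\<^esub> \<one>\<^bsub>H\<^esub>,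
     ring.zero = I, add = set_add H, smult = (\<lambda>c U. \<Union>x\<in>U. I +>\<^bsub>H\<^esub> (c \<odot>\<^bsub>H\<^esub> x))\<rparr>"

text \<open>
  The poset \<open>Quot\<^sub>g\<^sub>e\<^sub>n(H)\<close>, where \<open>H/I\<close> is represented by its kernel \<open>I\<close>: thus \<open>I\<close> is below \<open>J\<close>
  iff \<open>J \<subseteq> I\<close>.
\<close>

definition Quot_gen ::
  "('k, 'z) ring_scheme \<Rightarrow> ('k, 'h, 'x) module_scheme
    \<Rightarrow> ('h \<Rightarrow> (('h \<times> 'h) \<Rightarrow>\<^sub>0 int) set) \<Rightarrow> ('h \<Rightarrow> 'k) \<Rightarrow> 'h set gorder"
  where "Quot_gen K H \<Delta> \<epsilon> =
    \<lparr>carrier = {I. coideal K H \<Delta> \<epsilon> I \<and> right_ideal H I},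
     eq = (=), le = (\<lambda>I J. J \<subseteq> I)\<rparr>"


section \<open>Coinvariants, canonical maps and the Galois connection\<close>

text \<open>The subalgebra \<open>A\<^sup>c\<^sup>o\<^sup>H\<close>.\<close>

definition coinv ::
  "('k, 'z) ring_scheme \<Rightarrow> ('k, 'h, 'x) module_scheme \<Rightarrow> ('k, 'a, 'y) module_scheme
    \<Rightarrow> ('a \<Rightarrow> (('a \<times> 'h) \<Rightarrow>\<^sub>0 int) set) \<Rightarrow> 'a set"
  where "coinv K H A \<delta> = {a \<in> carrier A. \<delta> a = tens K A H a \<one>\<^bsub>H\<^esub>}"

text \<open>The subalgebra \<open>A\<^sup>c\<^sup>o\<^sup>Q\<close> for \<open>Q = H/I\<close>.\<close>

definition quot_coinv ::
  "('k, 'z) ring_scheme \<Rightarrow> ('k, 'h, 'x) module_scheme \<Rightarrow> ('k, 'a, 'y) module_scheme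
    \<Rightarrow> ('a \<Rightarrow> (('a \<times> 'h) \<Rightarrow>\<^sub>0 int) set) \<Rightarrow> 'h set \<Rightarrow> 'a set"
  where "quot_coinv K H A \<delta> I =
    {a \<in> carrier A.
       tensor_map K A (quot_module H I) (\<lambda>x. x) (\<lambda>h. I +>\<^bsub>H\<^esub> h) (\<delta> a) =
       tens K A (quot_module H I) a (I +>\<^bsub>H\<^esub> \<one>\<^bsub>H\<^esub>)}"

text \<open>The group \<open>A \<otimes>\<^bsub>B\<^esub> A\<close>.\<close>

definition self_tensor :: "('a, 'y) ring_scheme \<Rightarrow> 'a set \<Rightarrow> (('a \<times> 'a) \<Rightarrow>\<^sub>0 int) set monoid"
  where "self_tensor A B = tensor_group B (\<lambda>a b. a \<otimes>\<^bsub>A\<^esub> b) (\<lambda>b a. b \<otimes>\<^bsub>A\<^esub> a) A A"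

text \<open>
  The map \<open>a \<otimes> b \<mapsto> a b\<^sub>0 \<otimes> \<pi>(b\<^sub>1)\<close> into \<open>A \<otimes> N\<close>, where \<open>\<pi> : H \<rightarrow> N\<close>. It is \<open>can\<close> for \<open>N = H\<close> and
  \<open>\<pi> = id\<close>, and \<open>can\<^bsub>Q\<^esub>\<close> for the projection \<open>\<pi>\<close> to \<open>N = Q\<close>.
\<close>

definition canonical_map ::
  "('k, 'z) ring_scheme \<Rightarrow> ('k, 'a, 'y) module_scheme \<Rightarrow> ('k, 'n, 'w) module_scheme
    \<Rightarrow> ('a \<Rightarrow> (('a \<times> 'h) \<Rightarrow>\<^sub>0 int) set) \<Rightarrow> ('h \<Rightarrow> 'n)
    \<Rightarrow> (('a \<times> 'a) \<Rightarrow>\<^sub>0 int) set \<Rightarrow> (('a \<times> 'n) \<Rightarrow>\<^sub>0 int) set"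
  where "canonical_map K A N \<delta> \<pi> =
    (let T = add_monoid (tensor K A N) in
      tensor_lift T (\<lambda>a b. tensor_lift T (\<lambda>x h. tens K A N (a \<otimes>\<^bsub>A\<^esub> x) (\<pi> h)) (\<delta> b)))"

definition can_surjective ::
  "('k, 'z) ring_scheme \<Rightarrow> ('k, 'h, 'x) module_scheme \<Rightarrow> ('k, 'a, 'y) module_scheme
    \<Rightarrow> ('a \<Rightarrow> (('a \<times> 'h) \<Rightarrow>\<^sub>0 int) set) \<Rightarrow> bool"
  where "can_surjective K H A \<delta> \<longleftrightarrow>
    canonical_map K A H \<delta> (\<lambda>h. h) ` carrier (self_tensor A (coinv K H A \<delta>)) =
    carrier (tensor K A H)"

text \<open>\<open>A\<^sup>c\<^sup>o\<^sup>Q \<subseteq> A\<close> is \<open>Q\<close>-Galois, for \<open>Q = H/I\<close>.\<close>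

definition quot_Galois ::
  "('k, 'z) ring_scheme \<Rightarrow> ('k, 'h, 'x) module_scheme \<Rightarrow> ('k, 'a, 'y) module_scheme
    \<Rightarrow> ('a \<Rightarrow> (('a \<times> 'h) \<Rightarrow>\<^sub>0 int) set) \<Rightarrow> 'h set \<Rightarrow> bool"
  where "quot_Galois K H A \<delta> I \<longleftrightarrow>
    bij_betw (canonical_map K A (quot_module H I) \<delta> (\<lambda>h. I +>\<^bsub>H\<^esub> h))
      (carrier (self_tensor A (quot_coinv K H A \<delta> I)))
      (carrier (tensor K A (quot_module H I)))"

definition Sub_alg ::
  "('k, 'z) ring_scheme \<Rightarrow> ('k, 'a, 'y) module_scheme \<Rightarrow> 'a set \<Rightarrow> 'a set gorder"
  where "Sub_alg K A B\<^sub>0 =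
    \<lparr>carrier = {B. subring B A \<and> submodule B K A \<and> B\<^sub>0 \<subseteq> B}, eq = (=), le = (\<subseteq>)\<rparr>"

text \<open>
  The library's Galois connections are monotone, so the order-reversing pair \<open>(\<phi>, \<psi>)\<close> is presented
  as a connection to the dual of \<open>Sub_alg\<close>, with \<open>\<phi> = lower\<close> and \<open>\<psi> = upper\<close>.
\<close>

definition coinv_galcon ::
  "('k, 'z) ring_scheme \<Rightarrow> ('k, 'h, 'x) module_scheme
    \<Rightarrow> ('h \<Rightarrow> (('h \<times> 'h) \<Rightarrow>\<^sub>0 int) set) \<Rightarrow> ('h \<Rightarrow> 'k) \<Rightarrow> ('k, 'a, 'y) module_scheme
    \<Rightarrow> ('a \<Rightarrow> (('a \<times> 'h) \<Rightarrow>\<^sub>0 int) set) \<Rightarrow> ('h set, 'a set) galois"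
  where "coinv_galcon K H \<Delta> \<epsilon> A \<delta> =
    \<lparr>orderA = Quot_gen K H \<Delta> \<epsilon>,
     orderB = inv_gorder (Sub_alg K A (coinv K H A \<delta>)),
     lower = quot_coinv K H A \<delta>,
     upper = (\<lambda>B. \<Squnion>\<^bsub>Quot_gen K H \<Delta> \<epsilon>\<^esub>
                {I \<in> carrier (Quot_gen K H \<Delta> \<epsilon>). B \<subseteq> quot_coinv K H A \<delta> I})\<rparr>"

end

theory Submission
  imports Defs
begin

text \<open>
  The supremum defining \<open>\<psi>(\<phi>(Q))\<close> is taken over all \<open>H/J\<close> with \<open>B \<subseteq> A\<^sup>c\<^sup>o\<^sup>H\<^sup>/\<^sup>J\<close>, where
  \<open>B = A\<^sup>c\<^sup>o\<^sup>Q\<close> and \<open>Q = H/I\<close>. As \<open>Q\<close> is a member of that family, it is the supremum once every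
  member is below it, that is, once \<open>I \<subseteq> J\<close> for every member (\<open>ideal_subset_if_coinvariants_subset\<close>).

  Take \<open>q \<in> I\<close>. Since \<open>can\<close> is onto, \<open>1 \<otimes> q\<close> is the value of \<open>can\<close> at a formal sum \<open>r\<close> of pairs in
  \<open>A \<times> A\<close>. The maps \<open>can\<close>, \<open>can\<^sub>Q\<close> and \<open>can\<close> for \<open>H/J\<close> are all given on formal sums, the latter
  two being \<open>can\<close> followed by \<open>id \<otimes> \<pi>\<close> (\<open>frag_lift_canonical_tensor\<close>). Hence \<open>can\<^sub>Q\<close> sends the class of
  \<open>r\<close> in \<open>A \<otimes>\<^sub>B A\<close> to \<open>1 \<otimes> \<pi>\<^sub>I(q) = 0\<close>, and by injectivity this class is \<open>0\<close>. Because \<open>B\<close> also lies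
  in the coinvariants of \<open>H/J\<close>, the canonical map of \<open>H/J\<close> is well defined on the same group
  \<open>A \<otimes>\<^sub>B A\<close> (\<open>canonical_map_coset\<close>), so it sends the class of \<open>r\<close> to \<open>0\<close> too. Its value there
  is \<open>1 \<otimes> \<pi>\<^sub>J(q)\<close>. Over a field, \<open>1 \<otimes> x = 0\<close> in \<open>A \<otimes> H/J\<close> with \<open>1 \<noteq> 0\<close> in \<open>A\<close> forces \<open>x = 0\<close>
  (\<open>mem_if_one_tens_coset_eq_zero\<close>), so \<open>q \<in> J\<close>.

  Well-definedness of the canonical map over \<open>B\<close> is where the right ideal property enters: for
  \<open>s \<in> B\<close> one needs \<open>s\<^sub>0 b\<^sub>0 \<otimes> \<pi>(s\<^sub>1 b\<^sub>1)\<close> to depend only on \<open>s\<^sub>0 \<otimes> \<pi>(s\<^sub>1) = s \<otimes> \<pi>(1)\<close>, and it does as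
  \<open>\<pi>(h k)\<close> depends only on \<open>\<pi>(h)\<close> and \<open>k\<close> (\<open>mult_proj_tensor_mult\<close>).
\<close>

section \<open>Tensor products and their universal property\<close>

definition frag_lift :: "('g, 'x) monoid_scheme \<Rightarrow> ('p \<Rightarrow> 'g) \<Rightarrow> ('p \<Rightarrow>\<^sub>0 int) \<Rightarrow> 'g"
  where "frag_lift G f r =
    finprod G (\<lambda>p. f p [^]\<^bsub>G\<^esub> Poly_Mapping.lookup r p) (Poly_Mapping.keys r)"

context comm_group
begin

lemma frag_lift_hom:
  assumes f: "f \<in> P \<rightarrow> carrier G"
  shows "frag_lift G f \<in> hom (free_Abelian_group P) G"
proof (rule homI)
  fix r assume "r \<in> carrier (free_Abelian_group P)"
  then show "frag_lift G f r \<in> carrier G"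
    using f by (auto simp: frag_lift_def intro!: finprod_closed)
next
  fix r s
  assume rs: "r \<in> carrier (free_Abelian_group P)" "s \<in> carrier (free_Abelian_group P)"
  let ?U = "Poly_Mapping.keys r \<union> Poly_Mapping.keys s"
  have U: "f p \<in> carrier G" if "p \<in> ?U" for p
    using that rs f by auto
  \<comment> \<open>The supports of \<open>r\<close>, \<open>s\<close> and \<open>r + s\<close> differ, so all three products are taken over one set.\<close>
  have extend: "frag_lift G f t = finprod G (\<lambda>p. f p [^] Poly_Mapping.lookup t p) ?U"
    if "Poly_Mapping.keys t \<subseteq> ?U" for t
    unfolding frag_lift_def
    using that U by (intro finprod_mono_neutral_cong_left) (auto simp: in_keys_iff)
  have "frag_lift G f (r + s) =
      finprod G (\<lambda>p. f p [^] Poly_Mapping.lookup r p \<otimes> f p [^] Poly_Mapping.lookup s p) ?U"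
    unfolding extend[OF keys_add] lookup_add
    using U by (intro finprod_cong') (auto simp: int_pow_mult)
  also have "\<dots> = frag_lift G f r \<otimes> frag_lift G f s"
    unfolding extend[OF Un_upper1] extend[OF Un_upper2]
    using U by (intro finprod_multf) auto
  finally show "frag_lift G f (r \<otimes>\<^bsub>free_Abelian_group P\<^esub> s) = frag_lift G f r \<otimes> frag_lift G f s"
    by simp
qed

lemma frag_lift_of: "f p \<in> carrier G \<Longrightarrow> frag_lift G f (frag_of p) = f p"
  by (simp add: frag_lift_def finprod_singleton_swap[of "{p}"] finprod_insert)

lemma frag_hom_diff:
  assumes "f \<in> hom (free_Abelian_group P) G" "Poly_Mapping.keys r \<subseteq> P" "Poly_Mapping.keys s \<subseteq> P"
  shows "f (r - s) = f r \<otimes> inv (f s)"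
proof -
  interpret f: group_hom "free_Abelian_group P" G f
    using assms(1) by (simp add: group_hom_def group_hom_axioms_def)
  have "f (r \<otimes>\<^bsub>free_Abelian_group P\<^esub> inv\<^bsub>free_Abelian_group P\<^esub> s) = f r \<otimes> inv (f s)"
    using assms(2,3) by (subst f.hom_mult) (simp_all del: mult_free_Abelian_group inv_free_Abelian_group
      carrier_free_Abelian_group_iff add: f.hom_inv flip: carrier_free_Abelian_group_iff)
  then show ?thesis
    using assms(3) by simp
qed

lemma frag_hom_eqI:
  assumes "f \<in> hom (free_Abelian_group P) G" "g \<in> hom (free_Abelian_group P) G"
    and "\<And>p. p \<in> P \<Longrightarrow> f (frag_of p) = g (frag_of p)" and "Poly_Mapping.keys r \<subseteq> P"
  shows "f r = g r"
proof (rule free_Abelian_group_induct[OF assms(4)])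
  have "f \<one>\<^bsub>free_Abelian_group P\<^esub> = \<one>" "g \<one>\<^bsub>free_Abelian_group P\<^esub> = \<one>"
    using assms(1,2) by (auto intro!: hom_one simp del: one_free_Abelian_group)
  then show "f 0 = g 0"
    by simp
qed (simp_all add: assms(3) frag_hom_diff[OF assms(1)] frag_hom_diff[OF assms(2)])

end

definition balanced_map ::
  "'s set \<Rightarrow> ('m \<Rightarrow> 's \<Rightarrow> 'm) \<Rightarrow> ('s \<Rightarrow> 'n \<Rightarrow> 'n) \<Rightarrow> ('m, 'x) ring_scheme \<Rightarrow> ('n, 'y) ring_scheme
    \<Rightarrow> ('g, 'z) monoid_scheme \<Rightarrow> ('m \<Rightarrow> 'n \<Rightarrow> 'g) \<Rightarrow> bool"
  where "balanced_map S ra la M N G f \<longleftrightarrow>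
    (\<forall>m\<in>carrier M. \<forall>n\<in>carrier N. f m n \<in> carrier G) \<and>
    (\<forall>m\<in>carrier M. \<forall>m'\<in>carrier M. \<forall>n\<in>carrier N. f (m \<oplus>\<^bsub>M\<^esub> m') n = f m n \<otimes>\<^bsub>G\<^esub> f m' n) \<and>
    (\<forall>m\<in>carrier M. \<forall>n\<in>carrier N. \<forall>n'\<in>carrier N. f m (n \<oplus>\<^bsub>N\<^esub> n') = f m n \<otimes>\<^bsub>G\<^esub> f m n') \<and>
    (\<forall>m\<in>carrier M. \<forall>s\<in>S. \<forall>n\<in>carrier N. f (ra m s) n = f m (la s n))"

lemma keys_frag_diff2:
  "Poly_Mapping.keys (frag_of a - frag_of b - frag_of c) \<subseteq> {a, b, c}"
  using keys_diff[of "frag_of a - frag_of b" "frag_of c"] keys_diff[of "frag_of a" "frag_of b"]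
  by auto

lemma keys_frag_diff:
  "Poly_Mapping.keys (frag_of a - frag_of b) \<subseteq> {a, b}"
  using keys_diff[of "frag_of a" "frag_of b"]
  by auto

locale tensor_factors =
  fixes S :: "'s set" and ra :: "'m \<Rightarrow> 's \<Rightarrow> 'm" and la :: "'s \<Rightarrow> 'n \<Rightarrow> 'n"
    and M :: "('m, 'x) ring_scheme" and N :: "('n, 'y) ring_scheme"
  assumes left_add_closed: "\<lbrakk>m \<in> carrier M; m' \<in> carrier M\<rbrakk> \<Longrightarrow> m \<oplus>\<^bsub>M\<^esub> m' \<in> carrier M"
    and right_add_closed: "\<lbrakk>n \<in> carrier N; n' \<in> carrier N\<rbrakk> \<Longrightarrow> n \<oplus>\<^bsub>N\<^esub> n' \<in> carrier N"
    and left_act_closed: "\<lbrakk>m \<in> carrier M; s \<in> S\<rbrakk> \<Longrightarrow> ra m s \<in> carrier M"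
    and right_act_closed: "\<lbrakk>s \<in> S; n \<in> carrier N\<rbrakk> \<Longrightarrow> la s n \<in> carrier N"
begin

abbreviation (input) "Frag \<equiv> free_Abelian_group (carrier M \<times> carrier N)"
abbreviation (input) "Rel \<equiv> tensor_rel S ra la M N"
abbreviation (input) "Tens \<equiv> tensor_group S ra la M N"

lemma subgroup_tensor_rel: "subgroup Rel Frag"
  unfolding tensor_rel_def
  using left_add_closed right_add_closed left_act_closed right_act_closed
  by (intro group.generate_is_subgroup)
     (auto intro!: order_trans[OF keys_frag_diff2] order_trans[OF keys_frag_diff])

lemma normal_tensor_rel: "Rel \<lhd> Frag"
  by (simp add: abelian_free_Abelian_group comm_group.normal_iff_subgroup subgroup_tensor_rel)

lemma comm_group_tensor_group: "comm_group Tens"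
  unfolding tensor_group_def
  by (intro comm_group.abelian_FactGroup abelian_free_Abelian_group subgroup_tensor_rel)

lemma carrier_tensor_group: "carrier Tens = (\<lambda>r. Rel #>\<^bsub>Frag\<^esub> r) ` carrier Frag"
  by (simp add: tensor_group_def carrier_FactGroup)

lemma coset_hom: "(\<lambda>r. Rel #>\<^bsub>Frag\<^esub> r) \<in> hom Frag Tens"
  unfolding tensor_group_def by (rule normal.r_coset_hom_Mod[OF normal_tensor_rel])

lemma pure_tensor_closed:
  "\<lbrakk>m \<in> carrier M; n \<in> carrier N\<rbrakk> \<Longrightarrow> pure_tensor S ra la M N m n \<in> carrier Tens"
  by (auto simp: carrier_tensor_group pure_tensor_def)

lemma coset_eq_if_diff_rel:
  assumes "r - s \<in> Rel" "r \<in> carrier Frag" "s \<in> carrier Frag"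
  shows "Rel #>\<^bsub>Frag\<^esub> r = Rel #>\<^bsub>Frag\<^esub> s"
proof -
  have "r \<in> Rel #>\<^bsub>Frag\<^esub> s"
    unfolding r_coset_def using assms(1) by force
  then show ?thesis
    using assms subgroup_tensor_rel
    by (metis group.repr_independence group_free_Abelian_group)
qed

lemma coset_mult:
  assumes "r \<in> carrier Frag" "s \<in> carrier Frag"
  shows "(Rel #>\<^bsub>Frag\<^esub> r) \<otimes>\<^bsub>Tens\<^esub> (Rel #>\<^bsub>Frag\<^esub> s) = Rel #>\<^bsub>Frag\<^esub> (r + s)"
  using hom_mult[OF coset_hom assms] by simp

lemma balanced_map_pure_tensor: "balanced_map S ra la M N Tens (pure_tensor S ra la M N)"
proof -
  have rel: "r \<in> Rel" if
    "r \<in> ({frag_of (m \<oplus>\<^bsub>M\<^esub> m', n) - frag_of (m, n) - frag_of (m', n) | m m' n.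
         m \<in> carrier M \<and> m' \<in> carrier M \<and> n \<in> carrier N} \<union>
      {frag_of (m, n \<oplus>\<^bsub>N\<^esub> n') - frag_of (m, n) - frag_of (m, n') | m n n'.
         m \<in> carrier M \<and> n \<in> carrier N \<and> n' \<in> carrier N} \<union>
      {frag_of (ra m s, n) - frag_of (m, la s n) | m s n.
         m \<in> carrier M \<and> s \<in> S \<and> n \<in> carrier N})" for r
    unfolding tensor_rel_def using that by (rule generate.incl)
  have keys2: "Poly_Mapping.keys (frag_of a + frag_of b) \<subseteq> carrier M \<times> carrier N"
    if "a \<in> carrier M \<times> carrier N" "b \<in> carrier M \<times> carrier N" for a b
    using keys_add[of "frag_of a" "frag_of b"] that by auto
  have add_eq: "Rel #>\<^bsub>Frag\<^esub> frag_of x =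
      (Rel #>\<^bsub>Frag\<^esub> frag_of a) \<otimes>\<^bsub>Tens\<^esub> (Rel #>\<^bsub>Frag\<^esub> frag_of b)"
    if "frag_of x - frag_of a - frag_of b \<in> Rel"
      "x \<in> carrier M \<times> carrier N" "a \<in> carrier M \<times> carrier N" "b \<in> carrier M \<times> carrier N" for x a b
  proof -
    have "Rel #>\<^bsub>Frag\<^esub> frag_of x = Rel #>\<^bsub>Frag\<^esub> (frag_of a + frag_of b)"
      using that keys2[OF that(3,4)] by (intro coset_eq_if_diff_rel) (auto simp: algebra_simps)
    then show ?thesis
      using that by (simp add: coset_mult)
  qed
  show ?thesis
    unfolding balanced_map_def
  proof (intro conjI ballI)
    fix m n assume "m \<in> carrier M" "n \<in> carrier N"
    then show "pure_tensor S ra la M N m n \<in> carrier Tens"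
      by (rule pure_tensor_closed)
  next
    fix m m' n assume *: "m \<in> carrier M" "m' \<in> carrier M" "n \<in> carrier N"
    show "pure_tensor S ra la M N (m \<oplus>\<^bsub>M\<^esub> m') n =
        pure_tensor S ra la M N m n \<otimes>\<^bsub>Tens\<^esub> pure_tensor S ra la M N m' n"
      unfolding pure_tensor_def
      by (rule add_eq, rule rel) (use * left_add_closed in auto)
  next
    fix m n n' assume *: "m \<in> carrier M" "n \<in> carrier N" "n' \<in> carrier N"
    show "pure_tensor S ra la M N m (n \<oplus>\<^bsub>N\<^esub> n') =
        pure_tensor S ra la M N m n \<otimes>\<^bsub>Tens\<^esub> pure_tensor S ra la M N m n'"
      unfolding pure_tensor_def
      by (rule add_eq, rule rel) (use * right_add_closed in auto)
  next
    fix m s n assume *: "m \<in> carrier M" "s \<in> S" "n \<in> carrier N"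
    show "pure_tensor S ra la M N (ra m s) n = pure_tensor S ra la M N m (la s n)"
      unfolding pure_tensor_def
      by (rule coset_eq_if_diff_rel, rule rel) (use * left_act_closed right_act_closed in auto)
  qed
qed

context
  fixes G :: "('g, 'z) monoid_scheme" and f :: "'m \<Rightarrow> 'n \<Rightarrow> 'g"
  assumes G: "comm_group G" and f: "balanced_map S ra la M N G f"
begin

interpretation G: comm_group G by (fact G)

private lemma lift_hom: "frag_lift G (case_prod f) \<in> hom Frag G"
  using f by (intro G.frag_lift_hom) (auto simp: balanced_map_def)

private lemma lift_of:
  "\<lbrakk>m \<in> carrier M; n \<in> carrier N\<rbrakk> \<Longrightarrow> frag_lift G (case_prod f) (frag_of (m, n)) = f m n"
  using f by (subst G.frag_lift_of) (auto simp: balanced_map_def)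

text \<open>
  The extension of \<open>f\<close> to formal sums vanishes on each defining relation precisely because \<open>f\<close> is
  biadditive and balanced, and hence on the subgroup that they generate.
\<close>

lemma frag_lift_rel:
  assumes "r \<in> Rel"
  shows "frag_lift G (case_prod f) r = \<one>\<^bsub>G\<^esub>"
proof -
  interpret L: group_hom Frag G "frag_lift G (case_prod f)"
    using lift_hom by (simp add: group_hom_def group_hom_axioms_def)
  have lift_of': "frag_lift G (case_prod f) (frag_of p) = case_prod f p"
    and closed: "case_prod f p \<in> carrier G" if "p \<in> carrier M \<times> carrier N" for p
    using that f lift_of by (auto simp: balanced_map_def)
  have kernel: "frag_lift G (case_prod f) (frag_of x - frag_of a - frag_of b) = \<one>\<^bsub>G\<^esub>"
    if x: "x \<in> carrier M \<times> carrier N" and a: "a \<in> carrier M \<times> carrier N"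
      and b: "b \<in> carrier M \<times> carrier N"
      and sum: "case_prod f x = case_prod f a \<otimes>\<^bsub>G\<^esub> case_prod f b" for x a b
  proof -
    have keys: "Poly_Mapping.keys (frag_of x - frag_of a) \<subseteq> carrier M \<times> carrier N"
      using keys_frag_diff[of x a] x a by auto
    have "frag_lift G (case_prod f) (frag_of x - frag_of a - frag_of b) =
        case_prod f x \<otimes>\<^bsub>G\<^esub> inv\<^bsub>G\<^esub> case_prod f a \<otimes>\<^bsub>G\<^esub> inv\<^bsub>G\<^esub> case_prod f b"
      using x a b keys by (simp only: G.frag_hom_diff[OF lift_hom] lift_of' keys_frag_of insert_subset
          empty_subsetI simp_thms)
    also have "\<dots> = \<one>\<^bsub>G\<^esub>"
      unfolding sum by (metis G.inv_closed G.inv_solve_right' G.m_closed G.m_comm G.r_inv a b closed)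
    finally show ?thesis .
  qed
  have kernel': "frag_lift G (case_prod f) (frag_of x - frag_of a) = \<one>\<^bsub>G\<^esub>"
    if x: "x \<in> carrier M \<times> carrier N" and a: "a \<in> carrier M \<times> carrier N"
      and eq: "case_prod f x = case_prod f a" for x a
    using x a closed[OF a] by (simp only: G.frag_hom_diff[OF lift_hom] lift_of' eq keys_frag_of
        insert_subset empty_subsetI simp_thms G.r_inv)
  have "Rel \<subseteq> kernel Frag G (frag_lift G (case_prod f))"
    unfolding tensor_rel_def
  proof (rule group.generate_subgroup_incl[OF group_free_Abelian_group _ L.subgroup_kernel],
      intro Un_least subsetI; clarsimp simp: kernel_def)
    fix m m' n assume *: "m \<in> carrier M" "m' \<in> carrier M" "n \<in> carrier N"
    show "Poly_Mapping.keys (frag_of (m \<oplus>\<^bsub>M\<^esub> m', n) - frag_of (m, n) - frag_of (m', n))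
        \<subseteq> carrier M \<times> carrier N \<and>
      frag_lift G (case_prod f) (frag_of (m \<oplus>\<^bsub>M\<^esub> m', n) - frag_of (m, n) - frag_of (m', n)) = \<one>\<^bsub>G\<^esub>"
      using * f left_add_closed
      by (intro conjI kernel order_trans[OF keys_frag_diff2]) (auto simp: balanced_map_def)
  next
    fix m n n' assume *: "m \<in> carrier M" "n \<in> carrier N" "n' \<in> carrier N"
    show "Poly_Mapping.keys (frag_of (m, n \<oplus>\<^bsub>N\<^esub> n') - frag_of (m, n) - frag_of (m, n'))
        \<subseteq> carrier M \<times> carrier N \<and>
      frag_lift G (case_prod f) (frag_of (m, n \<oplus>\<^bsub>N\<^esub> n') - frag_of (m, n) - frag_of (m, n')) = \<one>\<^bsub>G\<^esub>"
      using * f right_add_closed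
      by (intro conjI kernel order_trans[OF keys_frag_diff2]) (auto simp: balanced_map_def)
  next
    fix m s n assume *: "m \<in> carrier M" "s \<in> S" "n \<in> carrier N"
    show "Poly_Mapping.keys (frag_of (ra m s, n) - frag_of (m, la s n)) \<subseteq> carrier M \<times> carrier N \<and>
      frag_lift G (case_prod f) (frag_of (ra m s, n) - frag_of (m, la s n)) = \<one>\<^bsub>G\<^esub>"
      using * f left_act_closed right_act_closed
      by (intro conjI kernel' order_trans[OF keys_frag_diff]) (auto simp: balanced_map_def)
  qed
  then show ?thesis
    using assms by (auto simp: kernel_def)
qed

text \<open>
  This is the form in which the lift is evaluated at an arbitrary element of the tensor product: the
  value can be computed from any representing formal sum, so one formal sum can be used for tensor
  products over different scalars and for different targets.
\<close>

lemma tensor_lift_coset: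
  assumes "r \<in> carrier Frag"
  shows "tensor_lift G f (Rel #>\<^bsub>Frag\<^esub> r) = frag_lift G (case_prod f) r"
proof -
  have const: "frag_lift G (case_prod f) s = frag_lift G (case_prod f) r"
    if s: "s \<in> Rel #>\<^bsub>Frag\<^esub> r" for s
  proof -
    obtain t where t: "t \<in> Rel" "s = t + r"
      using s by (auto simp: r_coset_def)
    then have "t \<in> carrier Frag"
      using subgroup_tensor_rel subgroup.subset by blast
    then have "frag_lift G (case_prod f) (t + r) = \<one>\<^bsub>G\<^esub> \<otimes>\<^bsub>G\<^esub> frag_lift G (case_prod f) r"
      using hom_mult[OF lift_hom _ assms, of t] frag_lift_rel[OF t(1)]
      by (simp only: mult_free_Abelian_group)
    then show ?thesis
      using t(2) hom_in_carrier[OF lift_hom assms] by (simp only: G.l_one)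
  qed
  have "r \<in> Rel #>\<^bsub>Frag\<^esub> r"
    by (rule group.rcos_self[OF group_free_Abelian_group assms subgroup_tensor_rel])
  then have "frag_lift G (case_prod f) ` (Rel #>\<^bsub>Frag\<^esub> r) = {frag_lift G (case_prod f) r}"
    using const by blast
  then have "the_elem (frag_lift G (case_prod f) ` (Rel #>\<^bsub>Frag\<^esub> r)) = frag_lift G (case_prod f) r"
    by (simp only: the_elem_eq)
  then show ?thesis
    by (simp only: tensor_lift_def frag_lift_def[abs_def] case_prod_unfold)
qed

lemma tensor_lift_pure_tensor:
  "\<lbrakk>m \<in> carrier M; n \<in> carrier N\<rbrakk> \<Longrightarrow> tensor_lift G f (pure_tensor S ra la M N m n) = f m n"
  unfolding pure_tensor_def by (subst tensor_lift_coset) (auto simp: lift_of)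

lemma tensor_lift_hom: "tensor_lift G f \<in> hom Tens G"
proof (rule homI)
  fix U assume "U \<in> carrier Tens"
  then obtain r where "r \<in> carrier Frag" "U = Rel #>\<^bsub>Frag\<^esub> r"
    unfolding carrier_tensor_group by blast
  then show "tensor_lift G f U \<in> carrier G"
    by (metis hom_in_carrier[OF lift_hom] tensor_lift_coset)
next
  fix U V assume "U \<in> carrier Tens" "V \<in> carrier Tens"
  then obtain r s where rs: "r \<in> carrier Frag" "s \<in> carrier Frag"
      "U = Rel #>\<^bsub>Frag\<^esub> r" "V = Rel #>\<^bsub>Frag\<^esub> s"
    unfolding carrier_tensor_group by blast
  then have sum: "r + s \<in> carrier Frag"
    using order_trans[OF keys_add[of r s]] by simp
  then show "tensor_lift G f (U \<otimes>\<^bsub>Tens\<^esub> V) = tensor_lift G f U \<otimes>\<^bsub>G\<^esub> tensor_lift G f V"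
    unfolding rs(3,4) coset_mult[OF rs(1,2)] tensor_lift_coset[OF sum]
      tensor_lift_coset[OF rs(1)] tensor_lift_coset[OF rs(2)]
    using hom_mult[OF lift_hom rs(1,2)] by simp
qed

end

text \<open>
  Pure tensors generate the tensor product, because their representatives generate the free abelian
  group.
\<close>

lemma tensor_hom_eqI:
  assumes "comm_group G" and h: "h \<in> hom Tens G" and g: "g \<in> hom Tens G"
    and eq: "\<And>m n. \<lbrakk>m \<in> carrier M; n \<in> carrier N\<rbrakk> \<Longrightarrow>
        h (pure_tensor S ra la M N m n) = g (pure_tensor S ra la M N m n)"
    and U: "U \<in> carrier Tens"
  shows "h U = g U"
proof -
  interpret G: comm_group G by fact
  obtain r where r: "r \<in> carrier Frag" "U = Rel #>\<^bsub>Frag\<^esub> r"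
    using U by (auto simp: carrier_tensor_group)
  have "(h \<circ> (\<lambda>r. Rel #>\<^bsub>Frag\<^esub> r)) r = (g \<circ> (\<lambda>r. Rel #>\<^bsub>Frag\<^esub> r)) r"
  proof (rule G.frag_hom_eqI)
    show "h \<circ> (\<lambda>r. Rel #>\<^bsub>Frag\<^esub> r) \<in> hom Frag G" "g \<circ> (\<lambda>r. Rel #>\<^bsub>Frag\<^esub> r) \<in> hom Frag G"
      by (rule hom_compose[OF coset_hom h] hom_compose[OF coset_hom g])+
    show "Poly_Mapping.keys r \<subseteq> carrier M \<times> carrier N"
      using r(1) by simp
    fix p assume "p \<in> carrier M \<times> carrier N"
    then show "(h \<circ> (\<lambda>r. Rel #>\<^bsub>Frag\<^esub> r)) (frag_of p) = (g \<circ> (\<lambda>r. Rel #>\<^bsub>Frag\<^esub> r)) (frag_of p)"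
      using eq by (auto simp: pure_tensor_def)
  qed
  then show ?thesis
    using r by simp
qed

end

section \<open>Tensor products over a field\<close>

lemma balanced_mapI:
  assumes "\<And>m n. \<lbrakk>m \<in> carrier M; n \<in> carrier N\<rbrakk> \<Longrightarrow> f m n \<in> carrier G"
    and "\<And>m m' n. \<lbrakk>m \<in> carrier M; m' \<in> carrier M; n \<in> carrier N\<rbrakk> \<Longrightarrow>
      f (m \<oplus>\<^bsub>M\<^esub> m') n = f m n \<otimes>\<^bsub>G\<^esub> f m' n"
    and "\<And>m n n'. \<lbrakk>m \<in> carrier M; n \<in> carrier N; n' \<in> carrier N\<rbrakk> \<Longrightarrow>
      f m (n \<oplus>\<^bsub>N\<^esub> n') = f m n \<otimes>\<^bsub>G\<^esub> f m n'"
    and "\<And>m s n. \<lbrakk>m \<in> carrier M; s \<in> S; n \<in> carrier N\<rbrakk> \<Longrightarrow> f (ra m s) n = f m (la s n)"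
  shows "balanced_map S ra la M N G f"
  using assms by (simp add: balanced_map_def)

abbreviation bilinear_map ::
  "('k, 'z) ring_scheme \<Rightarrow> ('k, 'm, 'x) module_scheme \<Rightarrow> ('k, 'n, 'y) module_scheme
    \<Rightarrow> ('g, 'w) monoid_scheme \<Rightarrow> ('m \<Rightarrow> 'n \<Rightarrow> 'g) \<Rightarrow> bool"
  where "bilinear_map K M N \<equiv>
    balanced_map (carrier K) (\<lambda>m c. c \<odot>\<^bsub>M\<^esub> m) (\<lambda>c n. c \<odot>\<^bsub>N\<^esub> n) M N"

text \<open>
  Tensor products over \<open>K\<close> use their two factors only through closure under addition and scalar
  multiplication. Closure is therefore what is assumed here; for \<^const>\<open>quot_module\<close> it follows from
  the compatibility of the projection with the operations.
\<close>

locale linear_tensor_factors =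
  tensor_factors "carrier K" "\<lambda>m c. c \<odot>\<^bsub>M\<^esub> m" "\<lambda>c n. c \<odot>\<^bsub>N\<^esub> n" M N
  for K :: "('k, 'z) ring_scheme" and M :: "('k, 'm, 'x) module_scheme"
    and N :: "('k, 'n, 'y) module_scheme"
begin

abbreviation (input) "TG \<equiv> tensor_group (carrier K) (\<lambda>m c. c \<odot>\<^bsub>M\<^esub> m) (\<lambda>c n. c \<odot>\<^bsub>N\<^esub> n) M N"
abbreviation (input) "T \<equiv> add_monoid (tensor K M N)"

lemma tensor_simps:
  "carrier (tensor K M N) = carrier TG"
  "add (tensor K M N) = monoid.mult TG"
  "ring.zero (tensor K M N) = one TG"
  by (simp_all add: tensor_def Let_def)

lemma comm_group_tensor: "comm_group T"
proof -
  interpret TG: comm_group TG by (rule comm_group_tensor_group)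
  show ?thesis
  proof (rule comm_groupI)
    fix U V assume "U \<in> carrier T" "V \<in> carrier T"
    then show "U \<otimes>\<^bsub>T\<^esub> V = V \<otimes>\<^bsub>T\<^esub> U"
      by (simp add: tensor_simps TG.m_comm)
  next
    fix U assume "U \<in> carrier T"
    then show "\<exists>V\<in>carrier T. V \<otimes>\<^bsub>T\<^esub> U = \<one>\<^bsub>T\<^esub>"
      by (intro bexI[of _ "inv\<^bsub>TG\<^esub> U"]) (simp_all add: tensor_simps)
  qed (simp_all add: tensor_simps TG.m_assoc)
qed

lemma hom_tensor: "hom T G = hom TG G"
  by (simp add: hom_def tensor_simps)

lemma bilinear_tens: "bilinear_map K M N T (tens K M N)"
  using balanced_map_pure_tensor
  by (simp add: balanced_map_def tens_def tensor_simps)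

lemma tens_closed:
  "\<lbrakk>m \<in> carrier M; n \<in> carrier N\<rbrakk> \<Longrightarrow> tens K M N m n \<in> carrier T"
  using bilinear_tens by (simp add: balanced_map_def)

lemma tens_add_left:
  "\<lbrakk>m \<in> carrier M; m' \<in> carrier M; n \<in> carrier N\<rbrakk> \<Longrightarrow>
    tens K M N (m \<oplus>\<^bsub>M\<^esub> m') n = tens K M N m n \<otimes>\<^bsub>T\<^esub> tens K M N m' n"
  using bilinear_tens by (simp add: balanced_map_def)

lemma tens_add_right:
  "\<lbrakk>m \<in> carrier M; n \<in> carrier N; n' \<in> carrier N\<rbrakk> \<Longrightarrow>
    tens K M N m (n \<oplus>\<^bsub>N\<^esub> n') = tens K M N m n \<otimes>\<^bsub>T\<^esub> tens K M N m n'"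
  using bilinear_tens by (simp add: balanced_map_def)

lemma tens_smult:
  "\<lbrakk>c \<in> carrier K; m \<in> carrier M; n \<in> carrier N\<rbrakk> \<Longrightarrow>
    tens K M N (c \<odot>\<^bsub>M\<^esub> m) n = tens K M N m (c \<odot>\<^bsub>N\<^esub> n)"
  using bilinear_tens by (simp add: balanced_map_def)

lemma lift_hom:
  "\<lbrakk>comm_group G; bilinear_map K M N G f\<rbrakk> \<Longrightarrow> tensor_lift G f \<in> hom T G"
  unfolding hom_tensor by (rule tensor_lift_hom)

lemma lift_tens:
  "\<lbrakk>comm_group G; bilinear_map K M N G f; m \<in> carrier M; n \<in> carrier N\<rbrakk> \<Longrightarrow>
    tensor_lift G f (tens K M N m n) = f m n"
  unfolding tens_def by (rule tensor_lift_pure_tensor)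

lemma hom_eqI:
  assumes "comm_group G" "h \<in> hom T G" "g \<in> hom T G"
    and "\<And>m n. \<lbrakk>m \<in> carrier M; n \<in> carrier N\<rbrakk> \<Longrightarrow> h (tens K M N m n) = g (tens K M N m n)"
    and "U \<in> carrier T"
  shows "h U = g U"
  using assms(5)
  by (intro tensor_hom_eqI[OF assms(1) assms(2,3)[unfolded hom_tensor] assms(4)[unfolded tens_def]])
    (simp_all add: tensor_simps)

text \<open>
  The multiplication of \<^const>\<open>tensor\<close> is defined by lifts into the bare group, all other maps by lifts
  into the additive monoid of the record. The two agree in carrier and operations, and a lift
  depends on nothing else.
\<close>

lemma finprod_add_monoid_tensor: "finprod T f B = finprod TG f B"
  by (simp add: finprod_def tensor_simps)

lemma int_pow_add_monoid_tensor: "x [^]\<^bsub>T\<^esub> (z :: int) = x [^]\<^bsub>TG\<^esub> z"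
  by (simp add: int_pow_def nat_pow_def m_inv_def Let_def tensor_simps)

lemma tensor_lift_add_monoid_tensor: "tensor_lift T f = tensor_lift TG f"
  by (simp add: tensor_lift_def fun_eq_iff finprod_add_monoid_tensor int_pow_add_monoid_tensor)

lemma tensor_mult:
  "U \<otimes>\<^bsub>tensor K M N\<^esub> V =
    tensor_lift T (\<lambda>m n. tensor_lift T (\<lambda>m' n'. tens K M N (m \<otimes>\<^bsub>M\<^esub> m') (n \<otimes>\<^bsub>N\<^esub> n')) V) U"
  unfolding tensor_lift_add_monoid_tensor by (simp add: tensor_def Let_def)

end

section \<open>Canonical maps\<close>

text \<open>
  The map \<open>x \<otimes> k \<mapsto> a x \<otimes> \<pi>(h k)\<close>, that is, left multiplication by \<open>a \<otimes> h\<close> followed by \<open>id \<otimes> \<pi>\<close>. With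
  \<open>\<pi> = id\<close> it expresses the product of \<open>A \<otimes> H\<close>, and with \<open>h = 1\<close> the canonical map, which is
  \<open>a \<otimes> b \<mapsto> mult_proj a 1 (\<delta> b)\<close>.
\<close>

definition mult_proj ::
  "('k, 'z) ring_scheme \<Rightarrow> ('k, 'a, 'y) module_scheme \<Rightarrow> ('k, 'h, 'x) module_scheme
    \<Rightarrow> ('k, 'n, 'w) module_scheme \<Rightarrow> ('h \<Rightarrow> 'n)
    \<Rightarrow> 'a \<Rightarrow> 'h \<Rightarrow> (('a \<times> 'h) \<Rightarrow>\<^sub>0 int) set \<Rightarrow> (('a \<times> 'n) \<Rightarrow>\<^sub>0 int) set"
  where "mult_proj K A H N \<pi> a h =
    tensor_lift (add_monoid (tensor K A N)) (\<lambda>x k. tens K A N (a \<otimes>\<^bsub>A\<^esub> x) (\<pi> (h \<otimes>\<^bsub>H\<^esub> k)))"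

definition canonical_tensor ::
  "('k, 'z) ring_scheme \<Rightarrow> ('k, 'a, 'y) module_scheme \<Rightarrow> ('k, 'n, 'w) module_scheme
    \<Rightarrow> ('a \<Rightarrow> (('a \<times> 'h) \<Rightarrow>\<^sub>0 int) set) \<Rightarrow> ('h \<Rightarrow> 'n)
    \<Rightarrow> 'a \<Rightarrow> 'a \<Rightarrow> (('a \<times> 'n) \<Rightarrow>\<^sub>0 int) set"
  where "canonical_tensor K A N \<delta> \<pi> a b =
    tensor_lift (add_monoid (tensor K A N)) (\<lambda>x h. tens K A N (a \<otimes>\<^bsub>A\<^esub> x) (\<pi> h)) (\<delta> b)"

lemma canonical_map_eq_lift:
  "canonical_map K A N \<delta> \<pi> = tensor_lift (add_monoid (tensor K A N)) (canonical_tensor K A N \<delta> \<pi>)"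
  by (simp add: canonical_map_def canonical_tensor_def[abs_def] Let_def)

text \<open>
  The surjections \<open>\<pi> : H \<rightarrow> N\<close> for which a canonical map can be formed. The last assumption says that
  right multiplication of \<open>H\<close> passes to \<open>N\<close>. It covers both \<open>N = H\<close> with the identity and the
  projections to \<open>H/I\<close> for a right ideal \<open>I\<close>, so \<open>can\<close> and \<open>can\<^sub>Q\<close> are treated at once.
\<close>

locale comodule_algebra_quotient =
  comodule_algebra K H \<Delta> \<epsilon> S A \<delta>
  for K :: "('k, 'z) ring_scheme" (structure)
    and H :: "('k, 'h, 'x) module_scheme" (structure)
    and \<Delta> and \<epsilon> and S
    and A :: "('k, 'a, 'y) module_scheme" (structure) and \<delta> +
  fixes N :: "('k, 'n, 'w) module_scheme" and \<pi> :: "'h \<Rightarrow> 'n"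
  assumes proj_surj: "carrier N = \<pi> ` carrier H"
    and proj_add: "\<lbrakk>h \<in> carrier H; h' \<in> carrier H\<rbrakk> \<Longrightarrow> \<pi> (h \<oplus>\<^bsub>H\<^esub> h') = \<pi> h \<oplus>\<^bsub>N\<^esub> \<pi> h'"
    and proj_smult: "\<lbrakk>c \<in> carrier K; h \<in> carrier H\<rbrakk> \<Longrightarrow> \<pi> (c \<odot>\<^bsub>H\<^esub> h) = c \<odot>\<^bsub>N\<^esub> \<pi> h"
    and proj_mult_cong: "\<lbrakk>h \<in> carrier H; h' \<in> carrier H; k \<in> carrier H; \<pi> h = \<pi> h'\<rbrakk> \<Longrightarrow>
      \<pi> (h \<otimes>\<^bsub>H\<^esub> k) = \<pi> (h' \<otimes>\<^bsub>H\<^esub> k)"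
begin

lemma ring_H: "ring H" by unfold_locales
lemma ring_A: "ring A" by unfold_locales
lemma cring_K: "cring K" by unfold_locales

lemmas H_closed = ring.ring_simprules(1,5,6)[OF ring_H]
lemmas A_closed = ring.ring_simprules(1,5,6)[OF ring_A]
lemmas H_distrib = ring.ring_simprules(13,23)[OF ring_H]
lemmas A_distrib = ring.ring_simprules(13,23)[OF ring_A]
lemmas A_assoc = ring.ring_simprules(11)[OF ring_A]

lemma proj_closed: "h \<in> carrier H \<Longrightarrow> \<pi> h \<in> carrier N"
  by (simp add: proj_surj)

sublocale AH: linear_tensor_factors K A H
  by unfold_locales (auto simp: H_closed A_closed)

sublocale AN: linear_tensor_factors K A N
proof unfold_locales
  fix n n' assume "n \<in> carrier N" "n' \<in> carrier N"
  then show "n \<oplus>\<^bsub>N\<^esub> n' \<in> carrier N"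
    by (auto simp: proj_surj H_closed simp flip: proj_add)
next
  fix c n assume "c \<in> carrier K" "n \<in> carrier N"
  then show "c \<odot>\<^bsub>N\<^esub> n \<in> carrier N"
    by (auto simp: proj_surj simp flip: proj_smult)
qed (auto simp: A_closed)

abbreviation (input) "TH \<equiv> add_monoid (tensor K A H)"
abbreviation (input) "TN \<equiv> add_monoid (tensor K A N)"

sublocale TN: comm_group TN
  by (rule AN.comm_group_tensor)

lemma bilinear_mult_proj:
  assumes "a \<in> carrier A" "h \<in> carrier H"
  shows "bilinear_map K A H TN (\<lambda>x k. tens K A N (a \<otimes>\<^bsub>A\<^esub> x) (\<pi> (h \<otimes>\<^bsub>H\<^esub> k)))"
proof (rule balanced_mapI)
  fix x k assume "x \<in> carrier A" "k \<in> carrier H"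
  then show "tens K A N (a \<otimes>\<^bsub>A\<^esub> x) (\<pi> (h \<otimes>\<^bsub>H\<^esub> k)) \<in> carrier TN"
    using assms by (intro AN.tens_closed) (auto simp: A_closed A_distrib H_closed proj_closed)
next
  fix x x' k assume "x \<in> carrier A" "x' \<in> carrier A" "k \<in> carrier H"
  then show "tens K A N (a \<otimes>\<^bsub>A\<^esub> (x \<oplus>\<^bsub>A\<^esub> x')) (\<pi> (h \<otimes>\<^bsub>H\<^esub> k)) =
      tens K A N (a \<otimes>\<^bsub>A\<^esub> x) (\<pi> (h \<otimes>\<^bsub>H\<^esub> k)) \<otimes>\<^bsub>TN\<^esub> tens K A N (a \<otimes>\<^bsub>A\<^esub> x') (\<pi> (h \<otimes>\<^bsub>H\<^esub> k))"
    using assms by (subst AN.tens_add_left[symmetric]) (auto simp: A_closed A_distrib H_closed proj_closed)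
next
  fix x k k' assume "x \<in> carrier A" "k \<in> carrier H" "k' \<in> carrier H"
  then show "tens K A N (a \<otimes>\<^bsub>A\<^esub> x) (\<pi> (h \<otimes>\<^bsub>H\<^esub> (k \<oplus>\<^bsub>H\<^esub> k'))) =
      tens K A N (a \<otimes>\<^bsub>A\<^esub> x) (\<pi> (h \<otimes>\<^bsub>H\<^esub> k)) \<otimes>\<^bsub>TN\<^esub> tens K A N (a \<otimes>\<^bsub>A\<^esub> x) (\<pi> (h \<otimes>\<^bsub>H\<^esub> k'))"
    using assms
    by (subst AN.tens_add_right[symmetric]) (auto simp: A_closed H_closed H_distrib proj_closed proj_add)
next
  fix x c k assume "x \<in> carrier A" "c \<in> carrier K" "k \<in> carrier H"
  then show "tens K A N (a \<otimes>\<^bsub>A\<^esub> (c \<odot>\<^bsub>A\<^esub> x)) (\<pi> (h \<otimes>\<^bsub>H\<^esub> k)) =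
      tens K A N (a \<otimes>\<^bsub>A\<^esub> x) (\<pi> (h \<otimes>\<^bsub>H\<^esub> (c \<odot>\<^bsub>H\<^esub> k)))"
    using assms
    by (simp add: A.smult_mult_right smult_mult_right AN.tens_smult proj_smult proj_closed
        A_closed H_closed)
qed

lemma mult_proj_hom:
  "\<lbrakk>a \<in> carrier A; h \<in> carrier H\<rbrakk> \<Longrightarrow> mult_proj K A H N \<pi> a h \<in> hom TH TN"
  unfolding mult_proj_def by (intro AH.lift_hom TN.comm_group_axioms bilinear_mult_proj)

lemma mult_proj_tens:
  "\<lbrakk>a \<in> carrier A; h \<in> carrier H; x \<in> carrier A; k \<in> carrier H\<rbrakk> \<Longrightarrow>
    mult_proj K A H N \<pi> a h (tens K A H x k) = tens K A N (a \<otimes>\<^bsub>A\<^esub> x) (\<pi> (h \<otimes>\<^bsub>H\<^esub> k))"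
  unfolding mult_proj_def
  by (subst AH.lift_tens[OF TN.comm_group_axioms bilinear_mult_proj]) simp_all

lemma mult_proj_add_left:
  assumes "a \<in> carrier A" "a' \<in> carrier A" "h \<in> carrier H" "V \<in> carrier TH"
  shows "mult_proj K A H N \<pi> (a \<oplus>\<^bsub>A\<^esub> a') h V =
    mult_proj K A H N \<pi> a h V \<otimes>\<^bsub>TN\<^esub> mult_proj K A H N \<pi> a' h V"
proof (rule AH.hom_eqI[OF TN.comm_group_axioms _ _ _ assms(4)])
  fix x k assume "x \<in> carrier A" "k \<in> carrier H"
  then show "mult_proj K A H N \<pi> (a \<oplus>\<^bsub>A\<^esub> a') h (tens K A H x k) =
    mult_proj K A H N \<pi> a h (tens K A H x k) \<otimes>\<^bsub>TN\<^esub> mult_proj K A H N \<pi> a' h (tens K A H x k)"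
    using assms by (simp add: mult_proj_tens A_closed A_distrib H_closed proj_closed
        AN.tens_add_left[simplified])
qed (use assms in \<open>auto intro!: mult_proj_hom TN.hom_group_mult[simplified] simp: A_closed\<close>)

lemma mult_proj_add_right:
  assumes "a \<in> carrier A" "h \<in> carrier H" "h' \<in> carrier H" "V \<in> carrier TH"
  shows "mult_proj K A H N \<pi> a (h \<oplus>\<^bsub>H\<^esub> h') V =
    mult_proj K A H N \<pi> a h V \<otimes>\<^bsub>TN\<^esub> mult_proj K A H N \<pi> a h' V"
proof (rule AH.hom_eqI[OF TN.comm_group_axioms _ _ _ assms(4)])
  fix x k assume "x \<in> carrier A" "k \<in> carrier H"
  then show "mult_proj K A H N \<pi> a (h \<oplus>\<^bsub>H\<^esub> h') (tens K A H x k) =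
    mult_proj K A H N \<pi> a h (tens K A H x k) \<otimes>\<^bsub>TN\<^esub> mult_proj K A H N \<pi> a h' (tens K A H x k)"
    using assms by (simp add: mult_proj_tens A_closed H_closed H_distrib proj_closed
        proj_add AN.tens_add_right[simplified])
qed (use assms in \<open>auto intro!: mult_proj_hom TN.hom_group_mult[simplified] simp: H_closed\<close>)

lemma mult_proj_smult:
  assumes "c \<in> carrier K" "a \<in> carrier A" "h \<in> carrier H" "V \<in> carrier TH"
  shows "mult_proj K A H N \<pi> (c \<odot>\<^bsub>A\<^esub> a) h V = mult_proj K A H N \<pi> a (c \<odot>\<^bsub>H\<^esub> h) V"
proof (rule AH.hom_eqI[OF TN.comm_group_axioms _ _ _ assms(4)])
  fix x k assume "x \<in> carrier A" "k \<in> carrier H"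
  then show "mult_proj K A H N \<pi> (c \<odot>\<^bsub>A\<^esub> a) h (tens K A H x k) =
    mult_proj K A H N \<pi> a (c \<odot>\<^bsub>H\<^esub> h) (tens K A H x k)"
    using assms by (simp add: mult_proj_tens A.smult_mult_left smult_mult_left AN.tens_smult
        proj_smult proj_closed A_closed H_closed)
qed (use assms in \<open>auto intro!: mult_proj_hom\<close>)

text \<open>
  Here the right action of \<open>H\<close> on \<open>N\<close> is used: only the class \<open>\<pi>(h)\<close> of the multiplier matters.
\<close>

lemma mult_proj_cong:
  assumes "a \<in> carrier A" "h \<in> carrier H" "h' \<in> carrier H" "\<pi> h = \<pi> h'" "V \<in> carrier TH"
  shows "mult_proj K A H N \<pi> a h V = mult_proj K A H N \<pi> a h' V"
proof (rule AH.hom_eqI[OF TN.comm_group_axioms _ _ _ assms(5)])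
  fix x k assume "x \<in> carrier A" "k \<in> carrier H"
  then show "mult_proj K A H N \<pi> a h (tens K A H x k) = mult_proj K A H N \<pi> a h' (tens K A H x k)"
    using assms by (simp add: mult_proj_tens proj_mult_cong[OF assms(2,3) _ assms(4)])
qed (use assms in \<open>auto intro!: mult_proj_hom\<close>)

lemma tens_proj_bilinear: "bilinear_map K A H TN (\<lambda>x k. tens K A N x (\<pi> k))"
  by (rule balanced_mapI)
    (simp_all add: proj_closed proj_add proj_smult AN.tens_closed[simplified] AN.tens_add_left[simplified]
      AN.tens_add_right[simplified] AN.tens_smult)

lemma tensor_proj_hom: "tensor_map K A N (\<lambda>x. x) \<pi> \<in> hom TH TN"
  unfolding tensor_map_def by (intro AH.lift_hom TN.comm_group_axioms tens_proj_bilinear)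

lemma tensor_proj_tens:
  "\<lbrakk>x \<in> carrier A; k \<in> carrier H\<rbrakk> \<Longrightarrow>
    tensor_map K A N (\<lambda>x. x) \<pi> (tens K A H x k) = tens K A N x (\<pi> k)"
  unfolding tensor_map_def by (rule AH.lift_tens[OF TN.comm_group_axioms tens_proj_bilinear])

lemma quotient_id: "comodule_algebra_quotient K H \<Delta> \<epsilon> S A \<delta> H (\<lambda>h. h)"
  by unfold_locales auto

interpretation id: comodule_algebra_quotient K H \<Delta> \<epsilon> S A \<delta> H "\<lambda>h. h"
  by (rule quotient_id)

lemma mult_proj_mult_proj:
  assumes "a \<in> carrier A" "u \<in> carrier A" "h \<in> carrier H" "V \<in> carrier TH"
  shows "mult_proj K A H N \<pi> a \<one>\<^bsub>H\<^esub> (mult_proj K A H H (\<lambda>h. h) u h V) =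
    mult_proj K A H N \<pi> (a \<otimes>\<^bsub>A\<^esub> u) h V"
proof -
  have "(mult_proj K A H N \<pi> a \<one>\<^bsub>H\<^esub> \<circ> mult_proj K A H H (\<lambda>h. h) u h) V =
      mult_proj K A H N \<pi> (a \<otimes>\<^bsub>A\<^esub> u) h V"
  proof (rule AH.hom_eqI[OF TN.comm_group_axioms _ _ _ assms(4)])
    show "mult_proj K A H N \<pi> a \<one>\<^bsub>H\<^esub> \<circ> mult_proj K A H H (\<lambda>h. h) u h \<in> hom TH TN"
      using assms by (intro Group.hom_compose[OF id.mult_proj_hom mult_proj_hom]) (auto simp: H_closed)
    show "mult_proj K A H N \<pi> (a \<otimes>\<^bsub>A\<^esub> u) h \<in> hom TH TN"
      using assms by (intro mult_proj_hom) (auto simp: A_closed)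
    fix x k assume "x \<in> carrier A" "k \<in> carrier H"
    then show "(mult_proj K A H N \<pi> a \<one>\<^bsub>H\<^esub> \<circ> mult_proj K A H H (\<lambda>h. h) u h) (tens K A H x k) =
        mult_proj K A H N \<pi> (a \<otimes>\<^bsub>A\<^esub> u) h (tens K A H x k)"
      using assms by (simp add: id.mult_proj_tens mult_proj_tens A_closed H_closed A_assoc
          ring.ring_simprules(12)[OF ring_H])
  qed
  then show ?thesis by simp
qed

text \<open>
  A map out of \<open>A \<otimes> N\<close> that sends \<open>u \<otimes> \<pi>(h)\<close> to an expression in \<open>h\<close> is written with a chosen preimage
  of each element of \<open>N\<close>. By \<open>mult_proj_cong\<close> the choice does not affect the value, which is why
  the result is bilinear although the choice is not.
\<close>

abbreviation (input) "repr \<equiv> inv_into (carrier H) \<pi>"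

lemma repr_closed: "n \<in> carrier N \<Longrightarrow> repr n \<in> carrier H"
  by (simp add: proj_surj inv_into_into)

lemma proj_repr: "n \<in> carrier N \<Longrightarrow> \<pi> (repr n) = n"
  by (simp add: proj_surj f_inv_into_f)

lemma mult_proj_repr_bilinear:
  assumes a: "a \<in> carrier A" and V: "V \<in> carrier TH"
  shows "bilinear_map K A N TN (\<lambda>u n. mult_proj K A H N \<pi> (a \<otimes>\<^bsub>A\<^esub> u) (repr n) V)"
proof (rule balanced_mapI)
  fix u n assume "u \<in> carrier A" "n \<in> carrier N"
  then show "mult_proj K A H N \<pi> (a \<otimes>\<^bsub>A\<^esub> u) (repr n) V \<in> carrier TN"
    using a V by (intro hom_in_carrier[OF mult_proj_hom V]) (auto simp: A_closed repr_closed)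
next
  fix u u' n assume "u \<in> carrier A" "u' \<in> carrier A" "n \<in> carrier N"
  then show "mult_proj K A H N \<pi> (a \<otimes>\<^bsub>A\<^esub> (u \<oplus>\<^bsub>A\<^esub> u')) (repr n) V =
      mult_proj K A H N \<pi> (a \<otimes>\<^bsub>A\<^esub> u) (repr n) V \<otimes>\<^bsub>TN\<^esub>
      mult_proj K A H N \<pi> (a \<otimes>\<^bsub>A\<^esub> u') (repr n) V"
    using a V by (simp only: A_distrib mult_proj_add_left A_closed repr_closed)
next
  fix u n n' assume *: "u \<in> carrier A" "n \<in> carrier N" "n' \<in> carrier N"
  then have "mult_proj K A H N \<pi> (a \<otimes>\<^bsub>A\<^esub> u) (repr (n \<oplus>\<^bsub>N\<^esub> n')) V =
      mult_proj K A H N \<pi> (a \<otimes>\<^bsub>A\<^esub> u) (repr n \<oplus>\<^bsub>H\<^esub> repr n') V"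
    using a by (intro mult_proj_cong[OF _ _ _ _ V])
      (simp_all add: A_closed H_closed repr_closed proj_repr proj_add AN.right_add_closed)
  then show "mult_proj K A H N \<pi> (a \<otimes>\<^bsub>A\<^esub> u) (repr (n \<oplus>\<^bsub>N\<^esub> n')) V =
      mult_proj K A H N \<pi> (a \<otimes>\<^bsub>A\<^esub> u) (repr n) V \<otimes>\<^bsub>TN\<^esub>
      mult_proj K A H N \<pi> (a \<otimes>\<^bsub>A\<^esub> u) (repr n') V"
    using a V * by (simp only: mult_proj_add_right A_closed repr_closed)
next
  fix u c n assume *: "u \<in> carrier A" "c \<in> carrier K" "n \<in> carrier N"
  then have "mult_proj K A H N \<pi> (a \<otimes>\<^bsub>A\<^esub> (c \<odot>\<^bsub>A\<^esub> u)) (repr n) V =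
      mult_proj K A H N \<pi> (a \<otimes>\<^bsub>A\<^esub> u) (c \<odot>\<^bsub>H\<^esub> repr n) V"
    using a V by (simp only: A.smult_mult_right mult_proj_smult A_closed repr_closed)
  also have "\<dots> = mult_proj K A H N \<pi> (a \<otimes>\<^bsub>A\<^esub> u) (repr (c \<odot>\<^bsub>N\<^esub> n)) V"
    using a * by (intro mult_proj_cong[OF _ _ _ _ V])
      (simp_all add: A_closed repr_closed proj_repr proj_smult AN.right_act_closed)
  finally show "mult_proj K A H N \<pi> (a \<otimes>\<^bsub>A\<^esub> (c \<odot>\<^bsub>A\<^esub> u)) (repr n) V =
      mult_proj K A H N \<pi> (a \<otimes>\<^bsub>A\<^esub> u) (repr (c \<odot>\<^bsub>N\<^esub> n)) V" .
qed

text \<open>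
  The decisive step: \<open>(a \<otimes> 1) W V\<close>, pushed to \<open>A \<otimes> N\<close>, depends on \<open>W\<close> only through its image under
  \<open>id \<otimes> \<pi>\<close>. Both sides are additive in \<open>W\<close>, and for \<open>W = u \<otimes> h\<close> they are left multiplication of \<open>V\<close>
  by \<open>a u \<otimes> h\<close>.
\<close>

lemma mult_proj_tensor_mult:
  assumes a: "a \<in> carrier A" and W: "W \<in> carrier TH" and V: "V \<in> carrier TH"
  shows "mult_proj K A H N \<pi> a \<one>\<^bsub>H\<^esub> (W \<otimes>\<^bsub>tensor K A H\<^esub> V) =
    tensor_lift TN (\<lambda>u n. mult_proj K A H N \<pi> (a \<otimes>\<^bsub>A\<^esub> u) (repr n) V)
      (tensor_map K A N (\<lambda>x. x) \<pi> W)"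
proof -
  let ?r = "\<lambda>u h. mult_proj K A H H (\<lambda>h. h) u h V"
  let ?q = "\<lambda>u n. mult_proj K A H N \<pi> (a \<otimes>\<^bsub>A\<^esub> u) (repr n) V"
  have r: "bilinear_map K A H TH ?r"
    by (rule balanced_mapI)
      (use V in \<open>simp_all only: id.mult_proj_add_left id.mult_proj_add_right id.mult_proj_smult
          hom_in_carrier[OF id.mult_proj_hom V]\<close>)
  have mult: "W \<otimes>\<^bsub>tensor K A H\<^esub> V = tensor_lift TH ?r W"
    unfolding AH.tensor_mult mult_proj_def ..
  have q: "bilinear_map K A N TN ?q"
    by (rule mult_proj_repr_bilinear[OF a V])
  have "(mult_proj K A H N \<pi> a \<one>\<^bsub>H\<^esub> \<circ> tensor_lift TH ?r) W =
      (tensor_lift TN ?q \<circ> tensor_map K A N (\<lambda>x. x) \<pi>) W"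
  proof (rule AH.hom_eqI[OF TN.comm_group_axioms _ _ _ W])
    show "mult_proj K A H N \<pi> a \<one>\<^bsub>H\<^esub> \<circ> tensor_lift TH ?r \<in> hom TH TN"
      using a by (intro Group.hom_compose[OF AH.lift_hom[OF AH.comm_group_tensor r] mult_proj_hom])
        (simp_all add: H_closed)
    show "tensor_lift TN ?q \<circ> tensor_map K A N (\<lambda>x. x) \<pi> \<in> hom TH TN"
      by (rule Group.hom_compose[OF tensor_proj_hom AN.lift_hom[OF TN.comm_group_axioms q]])
    fix u h assume uh: "u \<in> carrier A" "h \<in> carrier H"
    have "mult_proj K A H N \<pi> (a \<otimes>\<^bsub>A\<^esub> u) h V = ?q u (\<pi> h)"
      using a uh by (intro mult_proj_cong[OF _ _ _ _ V])
        (simp_all add: A_closed repr_closed proj_repr proj_closed)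
    then show "(mult_proj K A H N \<pi> a \<one>\<^bsub>H\<^esub> \<circ> tensor_lift TH ?r) (tens K A H u h) =
        (tensor_lift TN ?q \<circ> tensor_map K A N (\<lambda>x. x) \<pi>) (tens K A H u h)"
      using a uh
      by (simp only: comp_apply AH.lift_tens[OF AH.comm_group_tensor r] mult_proj_mult_proj[OF a _ _ V]
          tensor_proj_tens AN.lift_tens[OF TN.comm_group_axioms q] proj_closed)
  qed
  then show ?thesis
    by (simp only: mult comp_apply)
qed

definition coinvariants where
  "coinvariants =
    {b \<in> carrier A. tensor_map K A N (\<lambda>x. x) \<pi> (\<delta> b) = tens K A N b (\<pi> \<one>\<^bsub>H\<^esub>)}"

lemma coaction_closed: "b \<in> carrier A \<Longrightarrow> \<delta> b \<in> carrier TH"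
  using coaction_ring_hom by (auto simp: ring_hom_def)

text \<open>
  For \<open>W = \<delta> s\<close> with \<open>s\<close> coinvariant, \<open>(id \<otimes> \<pi>)(\<delta> s) = s \<otimes> \<pi>(1)\<close> is also the image of \<open>s \<otimes> 1\<close>, so \<open>\<delta> s\<close>
  acts as \<open>s \<otimes> 1\<close>. This is the balancedness of the canonical map.
\<close>

lemma mult_proj_coaction_coinvariants:
  assumes a: "a \<in> carrier A" and s: "s \<in> coinvariants" and b: "b \<in> carrier A"
  shows "mult_proj K A H N \<pi> a \<one>\<^bsub>H\<^esub> (\<delta> (s \<otimes>\<^bsub>A\<^esub> b)) =
    mult_proj K A H N \<pi> (a \<otimes>\<^bsub>A\<^esub> s) \<one>\<^bsub>H\<^esub> (\<delta> b)"
proof -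
  have sA: "s \<in> carrier A"
    using s by (simp add: coinvariants_def)
  note \<delta>b = coaction_closed[OF b]
  have "mult_proj K A H N \<pi> a \<one>\<^bsub>H\<^esub> (\<delta> (s \<otimes>\<^bsub>A\<^esub> b)) =
      mult_proj K A H N \<pi> a \<one>\<^bsub>H\<^esub> (\<delta> s \<otimes>\<^bsub>tensor K A H\<^esub> \<delta> b)"
    using coaction_ring_hom sA b by (simp add: ring_hom_def)
  also have "\<dots> = tensor_lift TN (\<lambda>u n. mult_proj K A H N \<pi> (a \<otimes>\<^bsub>A\<^esub> u) (repr n) (\<delta> b))
      (tens K A N s (\<pi> \<one>\<^bsub>H\<^esub>))"
    using s mult_proj_tensor_mult[OF a coaction_closed[OF sA] \<delta>b] by (simp add: coinvariants_def)
  also have "\<dots> = mult_proj K A H N \<pi> (a \<otimes>\<^bsub>A\<^esub> s) (repr (\<pi> \<one>\<^bsub>H\<^esub>)) (\<delta> b)"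
    by (rule AN.lift_tens[OF TN.comm_group_axioms mult_proj_repr_bilinear[OF a \<delta>b] sA])
      (simp add: proj_closed H_closed)
  also have "\<dots> = mult_proj K A H N \<pi> (a \<otimes>\<^bsub>A\<^esub> s) \<one>\<^bsub>H\<^esub> (\<delta> b)"
    using a sA by (intro mult_proj_cong[OF _ _ _ _ \<delta>b])
      (simp_all add: A_closed H_closed repr_closed proj_repr proj_closed)
  finally show ?thesis .
qed

abbreviation (input) "can_of \<equiv> canonical_tensor K A N \<delta> \<pi>"

lemma canonical_tensor_eq_mult_proj:
  assumes a: "a \<in> carrier A" and b: "b \<in> carrier A"
  shows "can_of a b = mult_proj K A H N \<pi> a \<one>\<^bsub>H\<^esub> (\<delta> b)"
proof -
  have l_one: "\<one>\<^bsub>H\<^esub> \<otimes>\<^bsub>H\<^esub> h = h" if "h \<in> carrier H" for h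
    using that by (rule ring.ring_simprules(12)[OF ring_H])
  have bil: "bilinear_map K A H TN (\<lambda>x h. tens K A N (a \<otimes>\<^bsub>A\<^esub> x) (\<pi> h))"
    using bilinear_mult_proj[OF a H_closed(3)]
    by (simp add: balanced_map_def l_one H_closed AH.right_act_closed)
  show ?thesis
    unfolding canonical_tensor_def
  proof (rule AH.hom_eqI[OF TN.comm_group_axioms AH.lift_hom[OF TN.comm_group_axioms bil]
        mult_proj_hom[OF a H_closed(3)] _ coaction_closed[OF b]])
    fix x k assume "x \<in> carrier A" "k \<in> carrier H"
    then show "tensor_lift TN (\<lambda>x h. tens K A N (a \<otimes>\<^bsub>A\<^esub> x) (\<pi> h)) (tens K A H x k) =
        mult_proj K A H N \<pi> a \<one>\<^bsub>H\<^esub> (tens K A H x k)"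
      using a by (simp only: AH.lift_tens[OF TN.comm_group_axioms bil] mult_proj_tens H_closed l_one)
  qed
qed

context
  fixes B
  assumes B: "B \<subseteq> coinvariants"
begin

lemma self_tensor_factors:
  "tensor_factors B (\<lambda>a b. a \<otimes>\<^bsub>A\<^esub> b) (\<lambda>b a. b \<otimes>\<^bsub>A\<^esub> a) A A"
  using B by unfold_locales (auto simp: A_closed coinvariants_def)

lemma canonical_tensor_balanced:
  "balanced_map B (\<lambda>a b. a \<otimes>\<^bsub>A\<^esub> b) (\<lambda>b a. b \<otimes>\<^bsub>A\<^esub> a) A A TN can_of"
proof (rule balanced_mapI)
  fix a b assume "a \<in> carrier A" "b \<in> carrier A"
  then show "can_of a b \<in> carrier TN"
    by (simp only: canonical_tensor_eq_mult_proj hom_in_carrier[OF mult_proj_hom coaction_closed] H_closed)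
next
  fix a a' b assume "a \<in> carrier A" "a' \<in> carrier A" "b \<in> carrier A"
  then show "can_of (a \<oplus>\<^bsub>A\<^esub> a') b = can_of a b \<otimes>\<^bsub>TN\<^esub> can_of a' b"
    by (simp only: canonical_tensor_eq_mult_proj A_closed H_closed mult_proj_add_left coaction_closed)
next
  fix a b b' assume *: "a \<in> carrier A" "b \<in> carrier A" "b' \<in> carrier A"
  have "can_of a (b \<oplus>\<^bsub>A\<^esub> b') = mult_proj K A H N \<pi> a \<one>\<^bsub>H\<^esub> (\<delta> (b \<oplus>\<^bsub>A\<^esub> b'))"
    using * by (simp only: canonical_tensor_eq_mult_proj A_closed)
  also have "\<delta> (b \<oplus>\<^bsub>A\<^esub> b') = \<delta> b \<otimes>\<^bsub>TH\<^esub> \<delta> b'"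
    using coaction_ring_hom * by (simp add: ring_hom_def)
  finally show "can_of a (b \<oplus>\<^bsub>A\<^esub> b') = can_of a b \<otimes>\<^bsub>TN\<^esub> can_of a b'"
    using *
    by (simp only: canonical_tensor_eq_mult_proj A_closed H_closed Group.hom_mult[OF mult_proj_hom] coaction_closed)
next
  fix a s b assume *: "a \<in> carrier A" "s \<in> B" "b \<in> carrier A"
  then have "s \<in> carrier A" "s \<in> coinvariants"
    using B by (auto simp: coinvariants_def)
  then show "can_of (a \<otimes>\<^bsub>A\<^esub> s) b = can_of a (s \<otimes>\<^bsub>A\<^esub> b)"
    using * by (simp only: canonical_tensor_eq_mult_proj A_closed mult_proj_coaction_coinvariants)
qed

lemma canonical_map_coset:
  assumes "Poly_Mapping.keys r \<subseteq> carrier A \<times> carrier A"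
  shows "canonical_map K A N \<delta> \<pi> (tensor_rel B (\<lambda>a b. a \<otimes>\<^bsub>A\<^esub> b) (\<lambda>b a. b \<otimes>\<^bsub>A\<^esub> a) A A
      #>\<^bsub>free_Abelian_group (carrier A \<times> carrier A)\<^esub> r) = frag_lift TN (case_prod can_of) r"
  unfolding canonical_map_eq_lift
  by (rule tensor_factors.tensor_lift_coset[OF self_tensor_factors TN.comm_group_axioms canonical_tensor_balanced])
    (use assms in simp)

lemma canonical_map_one:
  "canonical_map K A N \<delta> \<pi> \<one>\<^bsub>self_tensor A B\<^esub> = \<one>\<^bsub>TN\<^esub>"
proof -
  interpret self: tensor_factors B "\<lambda>a b. a \<otimes>\<^bsub>A\<^esub> b" "\<lambda>b a. b \<otimes>\<^bsub>A\<^esub> a" A A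
    by (rule self_tensor_factors)
  show ?thesis
    unfolding canonical_map_eq_lift self_tensor_def
    by (rule Group.hom_one[OF self.tensor_lift_hom[OF TN.comm_group_axioms canonical_tensor_balanced]])
      (simp_all only: comm_group.axioms(2) self.comm_group_tensor_group TN.comm_group_axioms)
qed

end

end

context comodule_algebra_quotient
begin

interpretation id: comodule_algebra_quotient K H \<Delta> \<epsilon> S A \<delta> H "\<lambda>h. h"
  by (rule quotient_id)

lemma canonical_tensor_eq_proj:
  assumes a: "a \<in> carrier A" and b: "b \<in> carrier A"
  shows "can_of a b = tensor_map K A N (\<lambda>x. x) \<pi> (canonical_tensor K A H \<delta> (\<lambda>h. h) a b)"
proof -
  have "mult_proj K A H N \<pi> a \<one>\<^bsub>H\<^esub> (\<delta> b) =
      (tensor_map K A N (\<lambda>x. x) \<pi> \<circ> mult_proj K A H H (\<lambda>h. h) a \<one>\<^bsub>H\<^esub>) (\<delta> b)"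
  proof (rule AH.hom_eqI[OF TN.comm_group_axioms mult_proj_hom[OF a H_closed(3)]
        Group.hom_compose[OF id.mult_proj_hom[OF a H_closed(3)] tensor_proj_hom] _ coaction_closed[OF b]])
    fix x k assume "x \<in> carrier A" "k \<in> carrier H"
    then show "mult_proj K A H N \<pi> a \<one>\<^bsub>H\<^esub> (tens K A H x k) =
        (tensor_map K A N (\<lambda>x. x) \<pi> \<circ> mult_proj K A H H (\<lambda>h. h) a \<one>\<^bsub>H\<^esub>) (tens K A H x k)"
      using a by (simp only: comp_apply mult_proj_tens id.mult_proj_tens tensor_proj_tens A_closed H_closed)
  qed
  then show ?thesis
    by (simp only: canonical_tensor_eq_mult_proj[OF a b] id.canonical_tensor_eq_mult_proj[OF a b] comp_apply)
qed

text \<open>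
  On formal sums, before any scalars are divided out, the canonical map of \<open>N\<close> is that of \<open>H\<close>
  followed by \<open>id \<otimes> \<pi>\<close>. This links the three canonical maps, whose domains are different tensor
  products.
\<close>

lemma frag_lift_canonical_tensor:
  assumes "Poly_Mapping.keys r \<subseteq> carrier A \<times> carrier A"
  shows "frag_lift TN (case_prod can_of) r =
    tensor_map K A N (\<lambda>x. x) \<pi> (frag_lift TH (case_prod (canonical_tensor K A H \<delta> (\<lambda>h. h))) r)"
proof -
  have closed: "case_prod can_of \<in> carrier A \<times> carrier A \<rightarrow> carrier TN"
    "case_prod (canonical_tensor K A H \<delta> (\<lambda>h. h)) \<in> carrier A \<times> carrier A \<rightarrow> carrier TH"
    using canonical_tensor_balanced[OF empty_subsetI] id.canonical_tensor_balanced[OF empty_subsetI]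
    by (auto simp: balanced_map_def)
  have "frag_lift TN (case_prod can_of) r =
      (tensor_map K A N (\<lambda>x. x) \<pi> \<circ> frag_lift TH (case_prod (canonical_tensor K A H \<delta> (\<lambda>h. h)))) r"
  proof (rule TN.frag_hom_eqI[OF TN.frag_lift_hom[OF closed(1)]
        Group.hom_compose[OF id.TN.frag_lift_hom[OF closed(2)] tensor_proj_hom] _ assms])
    fix p assume p: "p \<in> carrier A \<times> carrier A"
    then have "case_prod can_of p \<in> carrier TN" "case_prod (canonical_tensor K A H \<delta> (\<lambda>h. h)) p \<in> carrier TH"
      using closed by blast+
    moreover have "case_prod can_of p = tensor_map K A N (\<lambda>x. x) \<pi> (case_prod (canonical_tensor K A H \<delta> (\<lambda>h. h)) p)"
      using p canonical_tensor_eq_proj by (cases p) simp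
    ultimately show "frag_lift TN (case_prod can_of) (frag_of p) =
        (tensor_map K A N (\<lambda>x. x) \<pi> \<circ> frag_lift TH (case_prod (canonical_tensor K A H \<delta> (\<lambda>h. h)))) (frag_of p)"
      by (simp only: comp_apply TN.frag_lift_of id.TN.frag_lift_of)
  qed
  then show ?thesis
    by (simp only: comp_apply)
qed

text \<open>
  A functional \<open>f\<close> on \<open>N\<close>, given by its pullback to \<open>H\<close>, induces \<open>a \<otimes> n \<mapsto> f(n) a\<close> from \<open>A \<otimes> N\<close> to \<open>A\<close>, and
  this map sends \<open>1 \<otimes> \<pi>(h)\<close> to \<open>1\<close>.
\<close>

lemma one_tens_nonzero:
  assumes nonzero: "\<one>\<^bsub>A\<^esub> \<noteq> \<zero>\<^bsub>A\<^esub>"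
    and f: "f \<in> carrier H \<rightarrow> carrier K"
    and f_add: "\<And>h h'. \<lbrakk>h \<in> carrier H; h' \<in> carrier H\<rbrakk> \<Longrightarrow> f (h \<oplus>\<^bsub>H\<^esub> h') = f h \<oplus>\<^bsub>K\<^esub> f h'"
    and f_smult: "\<And>c h. \<lbrakk>c \<in> carrier K; h \<in> carrier H\<rbrakk> \<Longrightarrow> f (c \<odot>\<^bsub>H\<^esub> h) = c \<otimes>\<^bsub>K\<^esub> f h"
    and f_cong: "\<And>h h'. \<lbrakk>h \<in> carrier H; h' \<in> carrier H; \<pi> h = \<pi> h'\<rbrakk> \<Longrightarrow> f h = f h'"
    and h: "h \<in> carrier H" and fh: "f h = \<one>\<^bsub>K\<^esub>"
  shows "tens K A N \<one>\<^bsub>A\<^esub> (\<pi> h) \<noteq> \<one>\<^bsub>TN\<^esub>"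
proof
  assume zero: "tens K A N \<one>\<^bsub>A\<^esub> (\<pi> h) = \<one>\<^bsub>TN\<^esub>"
  let ?g = "\<lambda>a n. f (repr n) \<odot>\<^bsub>A\<^esub> a"
  have group_A: "comm_group (add_monoid A)"
    using A.a_comm_group .
  have f_closed: "f h \<in> carrier K" if "h \<in> carrier H" for h
    using f that by blast
  have bil: "bilinear_map K A N (add_monoid A) ?g"
  proof (rule balanced_mapI)
    fix a n assume "a \<in> carrier A" "n \<in> carrier N"
    then show "?g a n \<in> carrier (add_monoid A)"
      by (simp add: f_closed repr_closed)
  next
    fix a a' n assume "a \<in> carrier A" "a' \<in> carrier A" "n \<in> carrier N"
    then show "?g (a \<oplus>\<^bsub>A\<^esub> a') n = ?g a n \<otimes>\<^bsub>add_monoid A\<^esub> ?g a' n"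
      by (simp add: f_closed repr_closed A.smult_r_distr)
  next
    fix a n n' assume *: "a \<in> carrier A" "n \<in> carrier N" "n' \<in> carrier N"
    then have "f (repr (n \<oplus>\<^bsub>N\<^esub> n')) = f (repr n \<oplus>\<^bsub>H\<^esub> repr n')"
      by (intro f_cong) (simp_all add: H_closed repr_closed proj_repr proj_add AN.right_add_closed)
    then show "?g a (n \<oplus>\<^bsub>N\<^esub> n') = ?g a n \<otimes>\<^bsub>add_monoid A\<^esub> ?g a n'"
      using * by (simp add: f_add f_closed repr_closed A.smult_l_distr)
  next
    fix a c n assume *: "a \<in> carrier A" "c \<in> carrier K" "n \<in> carrier N"
    then have "f (repr (c \<odot>\<^bsub>N\<^esub> n)) = f (c \<odot>\<^bsub>H\<^esub> repr n)"
      by (intro f_cong) (simp_all add: repr_closed proj_repr proj_smult AN.right_act_closed)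
    also have "\<dots> = f (repr n) \<otimes>\<^bsub>K\<^esub> c"
      using * cring.cring_simprules(14)[OF cring_K, of c "f (repr n)"]
      by (simp add: f_smult f_closed repr_closed)
    finally show "?g (c \<odot>\<^bsub>A\<^esub> a) n = ?g a (c \<odot>\<^bsub>N\<^esub> n)"
      using * by (simp add: f_closed repr_closed A.smult_assoc1)
  qed
  have "tensor_lift (add_monoid A) ?g (tens K A N \<one>\<^bsub>A\<^esub> (\<pi> h)) = f (repr (\<pi> h)) \<odot>\<^bsub>A\<^esub> \<one>\<^bsub>A\<^esub>"
    using AN.lift_tens[OF group_A bil A_closed(3) proj_closed[OF h]] .
  also have "f (repr (\<pi> h)) = \<one>\<^bsub>K\<^esub>"
    using f_cong[of "repr (\<pi> h)" h] h fh by (simp add: repr_closed proj_repr proj_closed)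
  also have "\<one>\<^bsub>K\<^esub> \<odot>\<^bsub>A\<^esub> \<one>\<^bsub>A\<^esub> = \<one>\<^bsub>A\<^esub>"
    by (rule A.smult_one[OF A_closed(3)])
  finally have "tensor_lift (add_monoid A) ?g \<one>\<^bsub>TN\<^esub> = \<one>\<^bsub>A\<^esub>"
    by (simp only: zero)
  moreover have "tensor_lift (add_monoid A) ?g \<one>\<^bsub>TN\<^esub> = \<one>\<^bsub>add_monoid A\<^esub>"
    by (rule Group.hom_one[OF AN.lift_hom[OF group_A bil] TN.is_group comm_group.axioms(2)[OF group_A]])
  ultimately show False
    using nonzero by simp
qed

lemma tens_proj_zero:
  assumes "a \<in> carrier A"
  shows "tens K A N a (\<pi> \<zero>\<^bsub>H\<^esub>) = \<one>\<^bsub>TN\<^esub>"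
proof -
  have "\<zero>\<^bsub>H\<^esub> \<in> carrier H" "\<zero>\<^bsub>H\<^esub> \<oplus>\<^bsub>H\<^esub> \<zero>\<^bsub>H\<^esub> = \<zero>\<^bsub>H\<^esub>"
    by auto
  then have "tens K A N a (\<pi> \<zero>\<^bsub>H\<^esub>) = tens K A N a (\<pi> \<zero>\<^bsub>H\<^esub>) \<otimes>\<^bsub>TN\<^esub> tens K A N a (\<pi> \<zero>\<^bsub>H\<^esub>)"
    using AN.tens_add_right[OF assms, of "\<pi> \<zero>\<^bsub>H\<^esub>" "\<pi> \<zero>\<^bsub>H\<^esub>"] proj_add[of "\<zero>\<^bsub>H\<^esub>" "\<zero>\<^bsub>H\<^esub>"]
    by (simp only: proj_closed)
  then show ?thesis
    using TN.l_cancel_one'[OF AN.tens_closed AN.tens_closed, of a "\<pi> \<zero>\<^bsub>H\<^esub>" a "\<pi> \<zero>\<^bsub>H\<^esub>"] assms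
      proj_closed[OF \<open>\<zero>\<^bsub>H\<^esub> \<in> carrier H\<close>]
    by blast
qed

lemma coinv_subset_coinvariants: "coinv K H A \<delta> \<subseteq> id.coinvariants"
proof
  fix b assume b: "b \<in> coinv K H A \<delta>"
  then have bA: "b \<in> carrier A"
    by (simp add: coinv_def)
  have "tensor_map K A H (\<lambda>x. x) (\<lambda>h. h) (\<delta> b) = (\<lambda>U. U) (\<delta> b)"
    by (rule AH.hom_eqI[OF AH.comm_group_tensor id.tensor_proj_hom _ _ coaction_closed[OF bA]])
      (auto simp: hom_def id.tensor_proj_tens)
  then show "b \<in> id.coinvariants"
    using b by (simp add: id.coinvariants_def coinv_def)
qed

end
section \<open>Linear functionals\<close>

text \<open>
  By Zorn's lemma there is a submodule \<open>U \<supseteq> W\<close> maximal among those avoiding \<open>v\<close>. For \<open>x \<notin> U\<close> the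
  submodule \<open>U + R x\<close> contains \<open>v\<close>, and dividing by the coefficient of \<open>x\<close> gives \<open>x \<in> U + R v\<close>. So the
  module is the direct sum of \<open>U\<close> and \<open>R v\<close>, and \<open>f\<close> is the coordinate along \<open>v\<close>.
\<close>

lemma (in module) exists_separating_functional:
  assumes field: "field R" and W: "submodule W R M" and v: "v \<in> carrier M" "v \<notin> W"
  obtains f where "f \<in> carrier M \<rightarrow> carrier R"
    and "\<And>x y. \<lbrakk>x \<in> carrier M; y \<in> carrier M\<rbrakk> \<Longrightarrow> f (x \<oplus>\<^bsub>M\<^esub> y) = f x \<oplus> f y"
    and "\<And>c x. \<lbrakk>c \<in> carrier R; x \<in> carrier M\<rbrakk> \<Longrightarrow> f (c \<odot>\<^bsub>M\<^esub> x) = c \<otimes> f x"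
    and "\<And>w. w \<in> W \<Longrightarrow> f w = \<zero>" and "f v = \<one>"
proof -
  interpret field R by (rule field)
  define \<U> where "\<U> = {U. submodule U R M \<and> W \<subseteq> U \<and> v \<notin> U}"
  have "\<exists>U\<in>\<U>. \<forall>V\<in>\<U>. U \<subseteq> V \<longrightarrow> V = U"
  proof (rule subset_Zorn_nonempty)
    show "\<U> \<noteq> {}"
      using W v by (auto simp: \<U>_def)
    fix \<C> assume "\<C> \<noteq> {}" and chain: "subset.chain \<U> \<C>"
    then obtain U\<^sub>0 where U\<^sub>0: "U\<^sub>0 \<in> \<C>"
      by blast
    have mem: "submodule U R M" "W \<subseteq> U" "v \<notin> U" if "U \<in> \<C>" for U
      using chain that by (auto simp: subset.chain_def \<U>_def)
    have "submodule (\<Union>\<C>) R M"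
    proof (rule submoduleI)
      show "\<Union>\<C> \<subseteq> carrier M"
        using submoduleE(1)[OF mem(1)] by blast
      show "\<zero>\<^bsub>M\<^esub> \<in> \<Union>\<C>"
        using U\<^sub>0 subgroup.one_closed[OF submodule.axioms(1)[OF mem(1)[OF U\<^sub>0]]] by auto
      show "\<ominus>\<^bsub>M\<^esub> a \<in> \<Union>\<C>" if "a \<in> \<Union>\<C>" for a
        using that submoduleE(3)[OF mem(1)] by blast
      show "c \<odot>\<^bsub>M\<^esub> x \<in> \<Union>\<C>" if "c \<in> carrier R" "x \<in> \<Union>\<C>" for c x
        using that submoduleE(4)[OF mem(1)] by blast
      show "a \<oplus>\<^bsub>M\<^esub> b \<in> \<Union>\<C>" if ab: "a \<in> \<Union>\<C>" "b \<in> \<Union>\<C>" for a b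
      proof -
        obtain U V where "U \<in> \<C>" "V \<in> \<C>" "a \<in> U" "b \<in> V"
          using ab by blast
        moreover from this have "U \<subseteq> V \<or> V \<subseteq> U"
          using chain by (auto simp: subset.chain_def)
        ultimately show ?thesis
          using submoduleE(5)[OF mem(1)] by blast
      qed
    qed
    then show "\<Union>\<C> \<in> \<U>"
      using mem U\<^sub>0 by (auto simp: \<U>_def)
  qed
  then obtain U where U: "submodule U R M" "W \<subseteq> U" "v \<notin> U"
    and maximal: "\<And>V. \<lbrakk>submodule V R M; U \<subseteq> V; v \<notin> V\<rbrakk> \<Longrightarrow> V = U"
    unfolding \<U>_def by (auto intro: order_trans)
  have U_carrier: "u \<in> carrier M" if "u \<in> U" for u
    using submoduleE(1)[OF U(1)] that by blast
  have zero_U: "\<zero>\<^bsub>M\<^esub> \<in> U"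
    using subgroup.one_closed[OF submodule.axioms(1)[OF U(1)]] by simp
  note U_minus = submoduleE(3)[OF U(1)] and U_smult = submoduleE(4)[OF U(1)]
    and U_add = submoduleE(5)[OF U(1)]
  have ex: "\<exists>c\<in>carrier R. \<exists>u\<in>U. x = u \<oplus>\<^bsub>M\<^esub> c \<odot>\<^bsub>M\<^esub> v" if x: "x \<in> carrier M" for x
  proof (cases "x \<in> U")
    case True
    then show ?thesis
      using v U_carrier smult_l_null[OF v(1)] by (intro bexI[of _ \<zero>] bexI[of _ x]) auto
  next
    case False
    define V where "V = {u \<oplus>\<^bsub>M\<^esub> c \<odot>\<^bsub>M\<^esub> x | u c. u \<in> U \<and> c \<in> carrier R}"
    have "U \<subseteq> V"
    proof
      fix u assume "u \<in> U"
      then show "u \<in> V"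
        unfolding V_def using x U_carrier smult_l_null[OF x]
        by (intro CollectI exI[of _ u] exI[of _ \<zero>]) auto
    qed
    moreover have "x \<in> V"
      unfolding V_def using x zero_U by (intro CollectI exI[of _ "\<zero>\<^bsub>M\<^esub>"] exI[of _ \<one>]) auto
    moreover have "submodule V R M"
    proof (rule submoduleI)
      show "V \<subseteq> carrier M"
        using x U_carrier by (auto simp: V_def)
      show "\<zero>\<^bsub>M\<^esub> \<in> V"
        using \<open>U \<subseteq> V\<close> zero_U by blast
    next
      fix a assume "a \<in> V"
      then obtain u c where "a = u \<oplus>\<^bsub>M\<^esub> c \<odot>\<^bsub>M\<^esub> x" "u \<in> U" "c \<in> carrier R"
        by (auto simp: V_def)
      then show "\<ominus>\<^bsub>M\<^esub> a \<in> V"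
        unfolding V_def using x U_carrier U_minus
        by (intro CollectI exI[of _ "\<ominus>\<^bsub>M\<^esub> u"] exI[of _ "\<ominus> c"])
          (auto simp: smult_l_minus M.minus_add)
    next
      fix a b assume "a \<in> V" "b \<in> V"
      then obtain u c u' c' where "a = u \<oplus>\<^bsub>M\<^esub> c \<odot>\<^bsub>M\<^esub> x" "u \<in> U" "c \<in> carrier R"
          "b = u' \<oplus>\<^bsub>M\<^esub> c' \<odot>\<^bsub>M\<^esub> x" "u' \<in> U" "c' \<in> carrier R"
        by (auto simp: V_def)
      then show "a \<oplus>\<^bsub>M\<^esub> b \<in> V"
        unfolding V_def using x U_carrier U_add
        by (intro CollectI exI[of _ "u \<oplus>\<^bsub>M\<^esub> u'"] exI[of _ "c \<oplus> c'"])
          (auto simp: smult_l_distr M.a_ac)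
    next
      fix d a assume "d \<in> carrier R" "a \<in> V"
      then obtain u c where "a = u \<oplus>\<^bsub>M\<^esub> c \<odot>\<^bsub>M\<^esub> x" "u \<in> U" "c \<in> carrier R"
        by (auto simp: V_def)
      then show "d \<odot>\<^bsub>M\<^esub> a \<in> V"
        unfolding V_def using x U_carrier U_smult \<open>d \<in> carrier R\<close>
        by (intro CollectI exI[of _ "d \<odot>\<^bsub>M\<^esub> u"] exI[of _ "d \<otimes> c"])
          (auto simp: smult_r_distr smult_assoc1)
    qed
    ultimately have "v \<in> V"
      using maximal[of V] False by blast
    then obtain u c where uc: "v = u \<oplus>\<^bsub>M\<^esub> c \<odot>\<^bsub>M\<^esub> x" "u \<in> U" "c \<in> carrier R"
      by (auto simp: V_def)
    have "c \<noteq> \<zero>"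
      using uc U(3) smult_l_null[OF x] U_carrier by auto
    then have inv: "inv c \<in> carrier R" "inv c \<otimes> c = \<one>"
      using uc(3) field_Units by auto
    have cx: "c \<odot>\<^bsub>M\<^esub> x = \<ominus>\<^bsub>M\<^esub> u \<oplus>\<^bsub>M\<^esub> v"
      using uc x U_carrier by (simp add: M.r_neg1)
    have "x = inv c \<odot>\<^bsub>M\<^esub> (c \<odot>\<^bsub>M\<^esub> x)"
      using inv uc(3) x by (simp flip: smult_assoc1)
    also have "\<dots> = inv c \<odot>\<^bsub>M\<^esub> (\<ominus>\<^bsub>M\<^esub> u) \<oplus>\<^bsub>M\<^esub> inv c \<odot>\<^bsub>M\<^esub> v"
      unfolding cx using inv U_carrier[OF uc(2)] v by (intro smult_r_distr) auto
    finally show ?thesis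
      using inv U_smult U_minus uc(2) by blast
  qed
  \<comment> \<open>Otherwise a nonzero multiple of \<open>v\<close> lies in \<open>U\<close>, and so does \<open>v\<close>.\<close>
  have unique: "c = d" if eq: "u \<oplus>\<^bsub>M\<^esub> c \<odot>\<^bsub>M\<^esub> v = w \<oplus>\<^bsub>M\<^esub> d \<odot>\<^bsub>M\<^esub> v"
    and uw: "u \<in> U" "w \<in> U" and cd: "c \<in> carrier R" "d \<in> carrier R" for u w c d
  proof (rule ccontr)
    assume "c \<noteq> d"
    then have "c \<ominus> d \<noteq> \<zero>"
      using cd r_right_minus_eq by blast
    then have inv: "inv (c \<ominus> d) \<in> carrier R" "inv (c \<ominus> d) \<otimes> (c \<ominus> d) = \<one>"
      using cd field_Units by auto
    have car: "u \<in> carrier M" "w \<in> carrier M" "c \<odot>\<^bsub>M\<^esub> v \<in> carrier M" "d \<odot>\<^bsub>M\<^esub> v \<in> carrier M"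
      using uw U_carrier cd v by auto
    have "(c \<ominus> d) \<odot>\<^bsub>M\<^esub> v = c \<odot>\<^bsub>M\<^esub> v \<oplus>\<^bsub>M\<^esub> \<ominus>\<^bsub>M\<^esub> (d \<odot>\<^bsub>M\<^esub> v)"
      using cd v by (simp add: a_minus_def smult_l_distr smult_l_minus)
    also have "\<dots> = \<ominus>\<^bsub>M\<^esub> u \<oplus>\<^bsub>M\<^esub> (u \<oplus>\<^bsub>M\<^esub> c \<odot>\<^bsub>M\<^esub> v) \<oplus>\<^bsub>M\<^esub> \<ominus>\<^bsub>M\<^esub> (d \<odot>\<^bsub>M\<^esub> v)"
      using car by (simp add: M.r_neg1)
    also have "\<dots> = \<ominus>\<^bsub>M\<^esub> u \<oplus>\<^bsub>M\<^esub> w"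
      unfolding eq using car by (simp add: M.a_assoc M.r_neg)
    finally have "(c \<ominus> d) \<odot>\<^bsub>M\<^esub> v \<in> U"
      using uw U_minus U_add by simp
    then have "inv (c \<ominus> d) \<odot>\<^bsub>M\<^esub> ((c \<ominus> d) \<odot>\<^bsub>M\<^esub> v) \<in> U"
      using inv(1) U_smult by blast
    then show False
      using inv cd v U(3) by (simp flip: smult_assoc1)
  qed
  define f where "f x = (THE c. c \<in> carrier R \<and> (\<exists>u\<in>U. x = u \<oplus>\<^bsub>M\<^esub> c \<odot>\<^bsub>M\<^esub> v))" for x
  have f_eq: "f x = c" if "x = u \<oplus>\<^bsub>M\<^esub> c \<odot>\<^bsub>M\<^esub> v" "u \<in> U" "c \<in> carrier R" for x u c
    unfolding f_def by (rule the_equality) (use that unique in blast)+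
  show ?thesis
  proof (rule that)
    show "f \<in> carrier M \<rightarrow> carrier R"
      using ex f_eq by fastforce
    show "f w = \<zero>" if "w \<in> W" for w
      using that U(2) v U_carrier smult_l_null[OF v(1)] by (intro f_eq[of _ w]) auto
    show "f v = \<one>"
      using v zero_U by (intro f_eq[of _ "\<zero>\<^bsub>M\<^esub>"]) auto
  next
    fix x y assume "x \<in> carrier M" "y \<in> carrier M"
    then obtain c u d w where *: "c \<in> carrier R" "u \<in> U" "x = u \<oplus>\<^bsub>M\<^esub> c \<odot>\<^bsub>M\<^esub> v"
        "d \<in> carrier R" "w \<in> U" "y = w \<oplus>\<^bsub>M\<^esub> d \<odot>\<^bsub>M\<^esub> v"
      using ex by meson
    then have "f (x \<oplus>\<^bsub>M\<^esub> y) = c \<oplus> d"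
      using v U_carrier U_add by (intro f_eq[of _ "u \<oplus>\<^bsub>M\<^esub> w"]) (auto simp: smult_l_distr M.a_ac)
    then show "f (x \<oplus>\<^bsub>M\<^esub> y) = f x \<oplus> f y"
      using f_eq * by simp
  next
    fix a x assume a: "a \<in> carrier R" and "x \<in> carrier M"
    then obtain c u where *: "c \<in> carrier R" "u \<in> U" "x = u \<oplus>\<^bsub>M\<^esub> c \<odot>\<^bsub>M\<^esub> v"
      using ex by meson
    then have "f (a \<odot>\<^bsub>M\<^esub> x) = a \<otimes> c"
      using a v U_carrier U_smult
      by (intro f_eq[of _ "a \<odot>\<^bsub>M\<^esub> u"]) (auto simp: smult_r_distr smult_assoc1)
    then show "f (a \<odot>\<^bsub>M\<^esub> x) = a \<otimes> f x"
      using f_eq * by simp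
  qed
qed

section \<open>Generalised quotients and the Galois connection\<close>

context comodule_algebra
begin

lemma abelian_group_H: "abelian_group H"
  by unfold_locales

context
  fixes I
  assumes I: "submodule I K H" and right_ideal: "right_ideal H I"
begin

interpretation I: abelian_subgroup I H
  by (rule abelian_subgroupI2[OF abelian_group.a_comm_group[OF abelian_group_H]
        submodule.axioms(1)[OF I]])

lemma coset_eq_iff:
  assumes x: "x \<in> carrier H" and y: "y \<in> carrier H"
  shows "I +>\<^bsub>H\<^esub> x = I +>\<^bsub>H\<^esub> y \<longleftrightarrow> x \<ominus>\<^bsub>H\<^esub> y \<in> I"
proof
  assume "I +>\<^bsub>H\<^esub> x = I +>\<^bsub>H\<^esub> y"
  then show "x \<ominus>\<^bsub>H\<^esub> y \<in> I"
    using I.a_rcos_module[OF y x] I.a_rcos_self[OF x] by (simp add: a_minus_def)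
next
  assume "x \<ominus>\<^bsub>H\<^esub> y \<in> I"
  then show "I +>\<^bsub>H\<^esub> x = I +>\<^bsub>H\<^esub> y"
    using I.a_rcos_module[OF y x] abelian_group.a_repr_independence[OF abelian_group_H _ y I.a_subgroup]
    by (simp add: a_minus_def)
qed

lemma comodule_algebra_quot_module:
  "comodule_algebra_quotient K H \<Delta> \<epsilon> S A \<delta> (quot_module H I) (\<lambda>h. I +>\<^bsub>H\<^esub> h)"
proof (intro comodule_algebra_quotient.intro comodule_algebra_axioms
    comodule_algebra_quotient_axioms.intro)
  have ring: "ring H" by unfold_locales
  show "carrier (quot_module H I) = (\<lambda>h. I +>\<^bsub>H\<^esub> h) ` carrier H"
    by (auto simp: quot_module_def A_RCOSETS_def')
  fix h h' assume h: "h \<in> carrier H" and h': "h' \<in> carrier H"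
  then show "I +>\<^bsub>H\<^esub> (h \<oplus>\<^bsub>H\<^esub> h') = (I +>\<^bsub>H\<^esub> h) \<oplus>\<^bsub>quot_module H I\<^esub> (I +>\<^bsub>H\<^esub> h')"
    by (simp add: quot_module_def I.a_rcos_sum)
  fix k assume k: "k \<in> carrier H" and eq: "I +>\<^bsub>H\<^esub> h = I +>\<^bsub>H\<^esub> h'"
  have "(h \<ominus>\<^bsub>H\<^esub> h') \<otimes>\<^bsub>H\<^esub> k \<in> I"
    using right_ideal eq k h h' by (simp add: coset_eq_iff right_ideal_def)
  then show "I +>\<^bsub>H\<^esub> (h \<otimes>\<^bsub>H\<^esub> k) = I +>\<^bsub>H\<^esub> (h' \<otimes>\<^bsub>H\<^esub> k)"
    using h h' k ring
    by (simp add: coset_eq_iff a_minus_def ring.ring_simprules)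
next
  have ring: "ring H" by unfold_locales
  have module: "module K H" by unfold_locales
  fix c h assume c: "c \<in> carrier K" and h: "h \<in> carrier H"
  have "I +>\<^bsub>H\<^esub> (c \<odot>\<^bsub>H\<^esub> x) = I +>\<^bsub>H\<^esub> (c \<odot>\<^bsub>H\<^esub> h)" if x: "x \<in> I +>\<^bsub>H\<^esub> h" for x
  proof -
    have xH: "x \<in> carrier H"
      using x h I.a_subset by (auto simp: a_r_coset_def')
    have "x \<ominus>\<^bsub>H\<^esub> h \<in> I"
      using I.a_rcos_module[OF h xH] x by (simp add: a_minus_def)
    then have "c \<odot>\<^bsub>H\<^esub> (x \<ominus>\<^bsub>H\<^esub> h) \<in> I"
      using submodule.smult_closed[OF I c] by simp
    then show ?thesis
      using c h xH
      by (simp add: coset_eq_iff a_minus_def module.smult_r_distr[OF module]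
          module.smult_r_minus[OF module])
  qed
  then have "(\<Union>x\<in>I +>\<^bsub>H\<^esub> h. I +>\<^bsub>H\<^esub> (c \<odot>\<^bsub>H\<^esub> x)) = I +>\<^bsub>H\<^esub> (c \<odot>\<^bsub>H\<^esub> h)"
    using I.a_rcos_self[OF h] by blast
  then show "I +>\<^bsub>H\<^esub> (c \<odot>\<^bsub>H\<^esub> h) = c \<odot>\<^bsub>quot_module H I\<^esub> (I +>\<^bsub>H\<^esub> h)"
    by (simp add: quot_module_def)
qed

text \<open>
  If \<open>h \<notin> I\<close>, a functional that kills \<open>I\<close> and takes the value \<open>1\<close> at \<open>h\<close> detects \<open>1 \<otimes> (I + h)\<close>.
\<close>

lemma mem_if_one_tens_coset_eq_zero:
  assumes nonzero: "\<one>\<^bsub>A\<^esub> \<noteq> \<zero>\<^bsub>A\<^esub>" and h: "h \<in> carrier H"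
    and zero: "tens K A (quot_module H I) \<one>\<^bsub>A\<^esub> (I +>\<^bsub>H\<^esub> h) =
      \<one>\<^bsub>add_monoid (tensor K A (quot_module H I))\<^esub>"
  shows "h \<in> I"
proof (rule ccontr)
  assume "h \<notin> I"
  have module: "module K H" and field: "field K" and ring: "ring H"
    by unfold_locales
  obtain f where f: "f \<in> carrier H \<rightarrow> carrier K"
    and f_add: "\<And>x y. \<lbrakk>x \<in> carrier H; y \<in> carrier H\<rbrakk> \<Longrightarrow> f (x \<oplus>\<^bsub>H\<^esub> y) = f x \<oplus> f y"
    and f_smult: "\<And>c x. \<lbrakk>c \<in> carrier K; x \<in> carrier H\<rbrakk> \<Longrightarrow> f (c \<odot>\<^bsub>H\<^esub> x) = c \<otimes> f x"
    and f_I: "\<And>w. w \<in> I \<Longrightarrow> f w = \<zero>" and f_h: "f h = \<one>"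
    using module.exists_separating_functional[OF module field I h \<open>h \<notin> I\<close>] by blast
  have f_cong: "f x = f y" if xy: "x \<in> carrier H" "y \<in> carrier H" "I +>\<^bsub>H\<^esub> x = I +>\<^bsub>H\<^esub> y" for x y
  proof -
    have "f x = f ((x \<ominus>\<^bsub>H\<^esub> y) \<oplus>\<^bsub>H\<^esub> y)"
      using xy ring by (simp add: a_minus_def ring.ring_simprules)
    also have "\<dots> = f (x \<ominus>\<^bsub>H\<^esub> y) \<oplus> f y"
      using xy ring by (intro f_add) (simp_all add: ring.ring_simprules)
    also have "\<dots> = f y"
      using xy f f_I coset_eq_iff by (auto simp: Pi_iff)
    finally show ?thesis .
  qed
  show False
    using comodule_algebra_quotient.one_tens_nonzero[OF comodule_algebra_quot_module nonzero f f_add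
        f_smult f_cong h f_h] zero by blast
qed

end

text \<open>
  One formal sum \<open>r\<close> with \<open>can(r) = 1 \<otimes> q\<close> serves throughout. It is read in \<open>A \<otimes> A\<close> over \<open>A\<^sup>c\<^sup>o\<^sup>H\<close> and
  over the coinvariants of \<open>H/I\<close>, and mapped to \<open>A \<otimes> H\<close>, \<open>A \<otimes> H/I\<close> and \<open>A \<otimes> H/J\<close>. Injectivity over
  \<open>H/I\<close> makes its class zero, and the canonical map over \<open>H/J\<close> turns this into \<open>1 \<otimes> \<pi>\<^sub>J(q) = 0\<close>.
\<close>

theorem ideal_subset_if_coinvariants_subset:
  assumes nonzero: "\<one>\<^bsub>A\<^esub> \<noteq> \<zero>\<^bsub>A\<^esub>"
    and can: "can_surjective K H A \<delta>"
    and I: "submodule I K H" "right_ideal H I" and J: "submodule J K H" "right_ideal H J"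
    and Galois: "quot_Galois K H A \<delta> I"
    and subset: "quot_coinv K H A \<delta> I \<subseteq> quot_coinv K H A \<delta> J"
  shows "I \<subseteq> J"
proof
  interpret I: comodule_algebra_quotient K H \<Delta> \<epsilon> S A \<delta> "quot_module H I" "\<lambda>h. I +>\<^bsub>H\<^esub> h"
    by (rule comodule_algebra_quot_module[OF I])
  interpret J: comodule_algebra_quotient K H \<Delta> \<epsilon> S A \<delta> "quot_module H J" "\<lambda>h. J +>\<^bsub>H\<^esub> h"
    by (rule comodule_algebra_quot_module[OF J])
  interpret H: comodule_algebra_quotient K H \<Delta> \<epsilon> S A \<delta> H "\<lambda>h. h"
    by (rule I.quotient_id)
  let ?B = "quot_coinv K H A \<delta> I"
  let ?F = "free_Abelian_group (carrier A \<times> carrier A)"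
  let ?R = "\<lambda>B. tensor_rel B (\<lambda>a b. a \<otimes>\<^bsub>A\<^esub> b) (\<lambda>b a. b \<otimes>\<^bsub>A\<^esub> a) A A"
  have B_I: "?B \<subseteq> I.coinvariants"
    by (simp add: quot_coinv_def I.coinvariants_def)
  have B_J: "?B \<subseteq> J.coinvariants"
    using subset by (simp add: quot_coinv_def J.coinvariants_def)
  interpret AA: tensor_factors ?B "\<lambda>a b. a \<otimes>\<^bsub>A\<^esub> b" "\<lambda>b a. b \<otimes>\<^bsub>A\<^esub> a" A A
    by (rule I.self_tensor_factors[OF B_I])
  interpret AA_H: tensor_factors "coinv K H A \<delta>" "\<lambda>a b. a \<otimes>\<^bsub>A\<^esub> b" "\<lambda>b a. b \<otimes>\<^bsub>A\<^esub> a" A A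
    by (rule H.self_tensor_factors[OF I.coinv_subset_coinvariants])
  fix q assume "q \<in> I"
  then have q: "q \<in> carrier H"
    using submodule.axioms(1)[OF I(1)] subgroup.subset by fastforce
  have "tens K A H \<one>\<^bsub>A\<^esub> q \<in> carrier (tensor K A H)"
    using I.AH.tens_closed[OF I.A_closed(3) q] by simp
  then obtain Z where Z: "Z \<in> carrier (self_tensor A (coinv K H A \<delta>))"
    "canonical_map K A H \<delta> (\<lambda>h. h) Z = tens K A H \<one>\<^bsub>A\<^esub> q"
    using can unfolding can_surjective_def by (metis imageE)
  then obtain r where r: "Poly_Mapping.keys r \<subseteq> carrier A \<times> carrier A"
    and Z_r: "Z = ?R (coinv K H A \<delta>) #>\<^bsub>?F\<^esub> r"
    unfolding self_tensor_def AA_H.carrier_tensor_group by auto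
  have can_r: "frag_lift (add_monoid (tensor K A H)) (case_prod (canonical_tensor K A H \<delta> (\<lambda>h. h))) r =
      tens K A H \<one>\<^bsub>A\<^esub> q"
    using Z(2) unfolding Z_r H.canonical_map_coset[OF I.coinv_subset_coinvariants r] .
  have can_I_r: "canonical_map K A (quot_module H I) \<delta> (\<lambda>h. I +>\<^bsub>H\<^esub> h) (?R ?B #>\<^bsub>?F\<^esub> r) =
      tens K A (quot_module H I) \<one>\<^bsub>A\<^esub> (I +>\<^bsub>H\<^esub> q)"
    unfolding I.canonical_map_coset[OF B_I r] I.frag_lift_canonical_tensor[OF r] can_r
    by (rule I.tensor_proj_tens[OF I.A_closed(3) q])
  have can_J_r: "canonical_map K A (quot_module H J) \<delta> (\<lambda>h. J +>\<^bsub>H\<^esub> h) (?R ?B #>\<^bsub>?F\<^esub> r) =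
      tens K A (quot_module H J) \<one>\<^bsub>A\<^esub> (J +>\<^bsub>H\<^esub> q)"
    unfolding J.canonical_map_coset[OF B_J r] J.frag_lift_canonical_tensor[OF r] can_r
    by (rule J.tensor_proj_tens[OF I.A_closed(3) q])
  have "I +>\<^bsub>H\<^esub> q = I +>\<^bsub>H\<^esub> \<zero>\<^bsub>H\<^esub>"
    using \<open>q \<in> I\<close> q ring.ring_simprules(2)[OF I.ring_H]
    by (simp add: coset_eq_iff[OF I] a_minus_def)
  then have "canonical_map K A (quot_module H I) \<delta> (\<lambda>h. I +>\<^bsub>H\<^esub> h) (?R ?B #>\<^bsub>?F\<^esub> r) =
      canonical_map K A (quot_module H I) \<delta> (\<lambda>h. I +>\<^bsub>H\<^esub> h) \<one>\<^bsub>self_tensor A ?B\<^esub>"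
    using can_I_r I.canonical_map_one[OF B_I] I.tens_proj_zero[OF I.A_closed(3)] by simp
  moreover have "?R ?B #>\<^bsub>?F\<^esub> r \<in> carrier (self_tensor A ?B)"
    using r unfolding self_tensor_def AA.carrier_tensor_group by auto
  moreover have "\<one>\<^bsub>self_tensor A ?B\<^esub> \<in> carrier (self_tensor A ?B)"
    unfolding self_tensor_def by (intro monoid.one_closed group.is_monoid comm_group.axioms(2)
      AA.comm_group_tensor_group)
  ultimately have "?R ?B #>\<^bsub>?F\<^esub> r = \<one>\<^bsub>self_tensor A ?B\<^esub>"
    using Galois unfolding quot_Galois_def bij_betw_def by (meson inj_onD)
  then have "tens K A (quot_module H J) \<one>\<^bsub>A\<^esub> (J +>\<^bsub>H\<^esub> q) =
      \<one>\<^bsub>add_monoid (tensor K A (quot_module H J))\<^esub>"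
    using can_J_r J.canonical_map_one[OF B_J] by simp
  then show "q \<in> J"
    by (rule mem_if_one_tens_coset_eq_zero[OF J nonzero q])
qed

end

theorem proposition4p2:
  fixes K :: "('k, 'z) ring_scheme"
    and H :: "('k, 'h, 'x) module_scheme"
    and A :: "('k, 'a, 'y) module_scheme"
  assumes comodule: "comodule_algebra K H \<Delta> \<epsilon> S A \<delta>"
    and nonzero: "\<one>\<^bsub>A\<^esub> \<noteq> \<zero>\<^bsub>A\<^esub>"
    and can: "can_surjective K H A \<delta>"
    and Q: "Q \<in> carrier (Quot_gen K H \<Delta> \<epsilon>)"
    and Galois: "quot_Galois K H A \<delta> Q"
  shows "upper (coinv_galcon K H \<Delta> \<epsilon> A \<delta>) (lower (coinv_galcon K H \<Delta> \<epsilon> A \<delta>) Q) = Q"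
proof -
  let ?L = "Quot_gen K H \<Delta> \<epsilon>"
  let ?C = "{I \<in> carrier ?L. quot_coinv K H A \<delta> Q \<subseteq> quot_coinv K H A \<delta> I}"
  have greatest: "Q \<subseteq> I" if "I \<in> ?C" for I
    using that Q
    by (intro comodule_algebra.ideal_subset_if_coinvariants_subset[OF comodule nonzero can _ _ _ _ Galois])
      (auto simp: Quot_gen_def coideal_def)
  have least: "least ?L Q (Upper ?L ?C)"
    using Q greatest by (auto simp: least_def Upper_def Quot_gen_def)
  have "\<Squnion>\<^bsub>?L\<^esub> ?C = Q"
    unfolding sup_def
  proof (rule some_equality)
    show "least ?L Q (Upper ?L ?C)"
      by (rule least)
    fix U assume "least ?L U (Upper ?L ?C)"
    then have "U \<sqsubseteq>\<^bsub>?L\<^esub> Q" "Q \<sqsubseteq>\<^bsub>?L\<^esub> U"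
      using least unfolding least_def by blast+
    then show "U = Q"
      by (simp add: Quot_gen_def)
  qed
  then show ?thesis
    by (simp add: coinv_galcon_def)
qed

end
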